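(* Let $d\ge 1$ and let $\Phi:\mathbb{T}\to\mathbb{T}^d$ be any real-analytic mapping. Then $f\circ\Phi\in U(\mathbb{T})$ whenever $f\in A(\mathbb{T}^d)$.
   Context: $\mathbb{T}=\{z\in\mathbb{C}:|z|=1\}$ is the circle group, identified with $\mathbb{R}/\mathbb{Z}$ via $t\mapsto e^{2\pi i t}$, and $\mathbb{T}^d$ is the $d$-torus. $A(\mathbb{T}^d)$ is the space of continuous functions $f$ on $\mathbb{T}^d$ whose Fourier series converges absolutely, i.e. $\sum_{\overline n\in\mathbb{Z}^d}|\widehat f(\overline n)|<\infty$. $U(\mathbb{T})$ is the space of continuous functions $g$ on $\mathbb{T}$ whose Fourier series converges uniformly, i.e. the partial sums $S_Ng(x)=\sum_{|n|\le N}\widehat g(n)e^{2\pi i n x}$ satisfy $\|S_Ng-g\|_{L^\infty(\mathbb{T})}\to 0$ as $N\to\infty$. *)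

theory Defs
  imports "HOL-Analysis.Analysis"
begin

text \<open>
  The circle is the unit circle of the complex plane and the $d$-torus, with $d$ the cardinality
  of the index type (hence $d \ge 1$), is the set of vectors all of whose entries lie on it.
  Functions on these sets are total functions of which only the values on the set matter.
\<close>

definition circle :: "complex set" where
  "circle = sphere 0 1"

definition torus :: "(complex ^ 'd) set" where
  "torus = {z. \<forall>j. z $ j \<in> circle}"

text \<open>The identifications of $R/Z$ with the circle and of $(R/Z)^d$ with the torus.\<close>

definition circle_exp :: "real \<Rightarrow> complex" where
  "circle_exp t = exp (2 * pi * \<i> * t)"

definition torus_exp :: "real ^ 'd \<Rightarrow> complex ^ 'd" where
  "torus_exp x = (\<chi> j. circle_exp (x $ j))"

definition fourier_coeff :: "(complex \<Rightarrow> complex) \<Rightarrow> int \<Rightarrow> complex" where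
  "fourier_coeff g n =
     (LINT t:{0..1}|lborel. g (circle_exp t) * exp (- (2 * pi * \<i> * (of_int n * t))))"

definition torus_fourier_coeff :: "(complex ^ 'd \<Rightarrow> complex) \<Rightarrow> int ^ 'd \<Rightarrow> complex" where
  "torus_fourier_coeff f n =
     (LINT x:cbox 0 1|lborel.
        f (torus_exp x) * exp (- (2 * pi * \<i> * (\<Sum>j\<in>UNIV. of_int (n $ j) * x $ j))))"

definition fourier_partial_sum :: "(complex \<Rightarrow> complex) \<Rightarrow> nat \<Rightarrow> complex \<Rightarrow> complex" where
  "fourier_partial_sum g N z = (\<Sum>n = - int N..int N. fourier_coeff g n * z powi n)"

definition A_space :: "(complex ^ 'd \<Rightarrow> complex) set" where
  "A_space = {f. continuous_on torus f \<and> (\<lambda>n. norm (torus_fourier_coeff f n)) summable_on UNIV}"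

definition U_space :: "(complex \<Rightarrow> complex) set" where
  "U_space = {g. continuous_on circle g \<and>
                 uniform_limit circle (fourier_partial_sum g) g sequentially}"

definition real_analytic_on :: "(real \<Rightarrow> 'a::real_normed_vector) \<Rightarrow> real set \<Rightarrow> bool"
    (infixl \<open>real'_analytic'_on\<close> 50) where
  "\<phi> real_analytic_on S \<longleftrightarrow>
     (\<forall>t0\<in>S. \<exists>a r. r > 0 \<and> (\<forall>t\<in>ball t0 r. (\<lambda>k. (t - t0) ^ k *\<^sub>R a k) sums \<phi> t))"

text \<open>
  Real-analyticity for the quotient manifold structures of $R/Z$ and $(R/Z)^d$, whose charts are
  local inverses of the exponential maps: in such charts the map is locally given by a
  real-analytic lift.
\<close>

definition real_analytic_circle_map :: "(complex \<Rightarrow> complex ^ 'd) \<Rightarrow> bool" where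
  "real_analytic_circle_map \<Phi> \<longleftrightarrow>
     \<Phi> ` circle \<subseteq> torus \<and>
     (\<forall>t0. \<exists>\<delta>>0. \<exists>\<phi>. \<phi> real_analytic_on ball t0 \<delta> \<and>
        (\<forall>t\<in>ball t0 \<delta>. \<Phi> (circle_exp t) = torus_exp (\<phi> t)))"

end

theory Submission
  imports Defs
begin

text \<open>
  Expanding $f$ into its absolutely convergent Fourier series reduces the claim to a bound, uniform
  in $n \in Z^d$, $N$ and $x$, for the partial sums $S_N(e^{2\pi i n\cdot\Phi})(x)$, together with
  the convergence of $S_N g$ for each single $C^1$ function $g = e^{2\pi i n\cdot\Phi}$.
  Up to bounded terms the Dirichlet kernel is $\sin(Mt)/(\pi t)$, so the bound amounts to one for
  $\int (e^{iF(t)} - e^{iF(-t)})\,dt/t$, where $F$ ranges over the linear combinations of the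
  components of a local lift of $\Phi$ and of the function $t$. This is a finite-dimensional space of
  analytic functions: if $\lambda$ is the size of $F$ modulo constants, then for some $m$
  independent of $F$, near a given point, all derivatives up to order $m + 1$ are $O(\lambda)$, while one
  of order $k \le m$ is bounded below by a multiple of $\lambda$.
  For $|t| \le \lambda^{-1/(m+1)}$ the function $F$ may be replaced by its Taylor polynomial of degree $m$,
  to which the theorem of Stein and Wainger applies; for larger $|t|$ the estimate of van der Corput
  suffices.
\<close>

subsection \<open>Oscillatory integrals\<close>

lemma weighted_integral_bound:
  fixes u h h' :: "real \<Rightarrow> complex" and k :: "real \<Rightarrow> real"
  assumes ab: "a \<le> b" and u: "continuous_on {a..b} u"
    and B: "\<And>s. s \<in> {a..b} \<Longrightarrow> norm (integral {a..s} u) \<le> B"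
    and h: "\<And>t. t \<in> {a..b} \<Longrightarrow> (h has_vector_derivative h' t) (at t)"
    and h': "continuous_on {a..b} h'"
    and k: "k integrable_on {a..b}" "\<And>t. t \<in> {a..b} \<Longrightarrow> norm (h' t) \<le> k t"
  shows "norm (integral {a..b} (\<lambda>t. h t * u t)) \<le> B * (norm (h b) + integral {a..b} k)"
proof -
  define U where "U s = integral {a..s} u" for s
  have contU: "continuous_on {a..b} U"
    unfolding U_def using integrable_continuous_real[OF u] by (rule indefinite_integral_continuous_1)
  have conth: "continuous_on {a..b} h"
    using h by (meson continuous_at_imp_continuous_on has_vector_derivative_continuous)
  have dU: "(U has_vector_derivative u t) (at t)" if "t \<in> {a<..<b}" for t
    using integral_has_vector_derivative[OF u, of t] that
    by (auto simp: U_def[abs_def] at_within_Icc_at)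
  have Ua: "U a = 0" by (simp add: U_def)
  have int_h'U: "(\<lambda>t. h' t * U t) integrable_on {a..b}"
    by (intro integrable_continuous_real continuous_intros contU h')
  have "((\<lambda>t. U t * h' t) has_integral integral {a..b} (\<lambda>t. h' t * U t)) {a..b}"
    using integrable_integral[OF int_h'U] by (simp add: mult.commute)
  then have "((\<lambda>t. u t * h t) has_integral (U b * h b - integral {a..b} (\<lambda>t. h' t * U t))) {a..b}"
    by (intro integration_by_parts_interior[OF bounded_bilinear_mult ab contU conth dU h]) (auto simp: Ua)
  then have eq: "integral {a..b} (\<lambda>t. h t * u t) = h b * U b - integral {a..b} (\<lambda>t. h' t * U t)"
    by (simp add: integral_unique mult.commute)
  have "norm (integral {a..b} (\<lambda>t. h' t * U t)) \<le> integral {a..b} (\<lambda>t. k t * B)"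
  proof (rule integral_norm_bound_integral[OF int_h'U])
    show "(\<lambda>t. k t * B) integrable_on {a..b}" using k(1) by (rule integrable_on_mult_left)
    fix t assume t: "t \<in> {a..b}"
    then show "norm (h' t * U t) \<le> k t * B"
      unfolding norm_mult by (intro mult_mono k B[folded U_def]) (auto intro: order_trans[OF norm_ge_zero k(2)])
  qed
  also have "\<dots> = integral {a..b} k * B" by simp
  finally have "norm (integral {a..b} (\<lambda>t. h' t * U t)) \<le> integral {a..b} k * B" .
  moreover have "norm (h b * U b) \<le> norm (h b) * B"
    unfolding norm_mult using B[of b] ab by (intro mult_left_mono) (auto simp: U_def)
  ultimately show ?thesis
    unfolding eq by (intro order_trans[OF norm_triangle_ineq4]) (simp add: algebra_simps)
qed

lemma has_vector_derivative_cis: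
  assumes "(F has_real_derivative F') (at t)"
  shows "((\<lambda>t. cis (F t)) has_vector_derivative \<i> * of_real F' * cis (F t)) (at t)"
  using has_derivative_cis[of F "\<lambda>h. h * F'" t UNIV] assms
  unfolding has_vector_derivative_def has_field_derivative_def
  by (simp add: scaleR_conv_of_real algebra_simps mult_commute_abs)

lemma oscillatory_integral_first:
  assumes ab: "a \<le> b" and s: "0 < s"
    and D0: "\<And>t. t \<in> {a..b} \<Longrightarrow> (F has_real_derivative F1 t) (at t)"
    and D1: "\<And>t. t \<in> {a..b} \<Longrightarrow> (F1 has_real_derivative F2 t) (at t)"
    and F2: "continuous_on {a..b} F2"
    and ge: "\<And>t. t \<in> {a..b} \<Longrightarrow> s \<le> F1 t"
    and M: "integral {a..b} (\<lambda>t. \<bar>F2 t\<bar> / (F1 t)\<^sup>2) \<le> M"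
  shows "norm (integral {a..b} (\<lambda>t. cis (F t))) \<le> 2 * (1 / s + M)"
proof -
  have cF: "continuous_on {a..b} F" "continuous_on {a..b} F1"
    using D0 D1 by (meson DERIV_isCont continuous_at_imp_continuous_on)+
  have nz: "F1 t \<noteq> 0" if "t \<in> {a..b}" for t using ge[OF that] s by auto
  define u where "u t = \<i> * of_real (F1 t) * cis (F t)" for t
  define h where "h t = - \<i> * of_real (inverse (F1 t))" for t
  define h' where "h' t = \<i> * of_real (F2 t / (F1 t)\<^sup>2)" for t
  have u: "continuous_on {a..b} u"
    unfolding u_def by (intro continuous_intros cF)
  have "norm (integral {a..b} (\<lambda>t. h t * u t)) \<le> 2 * (norm (h b) + integral {a..b} (\<lambda>t. \<bar>F2 t\<bar> / (F1 t)\<^sup>2))"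
  proof (rule weighted_integral_bound[OF ab u])
    fix r assume r: "r \<in> {a..b}"
    have "(u has_integral (cis (F r) - cis (F a))) {a..r}"
      unfolding u_def using r ab
      by (intro fundamental_theorem_of_calculus)
        (auto intro!: has_vector_derivative_at_within has_vector_derivative_cis D0)
    then show "norm (integral {a..r} u) \<le> 2"
      by (simp add: integral_unique) (rule order_trans[OF norm_triangle_ineq4], simp)
  next
    fix t assume t: "t \<in> {a..b}"
    have "((\<lambda>t. inverse (F1 t)) has_real_derivative - (F2 t / (F1 t)\<^sup>2)) (at t)"
      using DERIV_inverse_fun[OF D1[OF t] nz[OF t]] by (simp add: power2_eq_square field_simps numeral_2_eq_2)
    then have "((\<lambda>t. complex_of_real (inverse (F1 t))) has_vector_derivative of_real (- (F2 t / (F1 t)\<^sup>2))) (at t)"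
      by (intro has_vector_derivative_of_real) (simp add: has_real_derivative_iff_has_vector_derivative)
    from has_vector_derivative_mult_right[OF this, of "-\<i>"]
    show "(h has_vector_derivative h' t) (at t)"
      unfolding h_def[abs_def] h'_def by simp
  next
    show "continuous_on {a..b} h'"
      unfolding h'_def by (intro continuous_intros cF F2) (use nz in auto)
    show "(\<lambda>t. \<bar>F2 t\<bar> / (F1 t)\<^sup>2) integrable_on {a..b}"
      by (intro integrable_continuous_real continuous_intros cF F2) (use nz in auto)
  qed (simp add: h'_def norm_mult norm_divide norm_power)
  also have "\<dots> \<le> 2 * (1 / s + M)"
  proof -
    have "norm (h b) = 1 / F1 b"
      unfolding h_def norm_mult norm_of_real using ge[of b] s ab by (simp add: inverse_eq_divide)
    also have "\<dots> \<le> 1 / s"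
      using ge[of b] s ab by (intro divide_left_mono) auto
    finally show ?thesis using M by simp
  qed
  also have "integral {a..b} (\<lambda>t. h t * u t) = integral {a..b} (\<lambda>t. cis (F t))"
  proof (rule integral_cong)
    fix t assume "t \<in> {a..b}"
    then have "complex_of_real (inverse (F1 t)) * of_real (F1 t) = 1"
      using nz by (simp flip: of_real_mult)
    then show "h t * u t = cis (F t)" unfolding h_def u_def by (simp add: algebra_simps)
  qed
  finally show ?thesis .
qed

lemma integral_derivative_over_square:
  fixes F1 F2 :: "real \<Rightarrow> real"
  assumes ab: "a \<le> b" and s: "0 < s"
    and D1: "\<And>t. t \<in> {a..b} \<Longrightarrow> (F1 has_real_derivative F2 t) (at t)"
    and ge: "\<And>t. t \<in> {a..b} \<Longrightarrow> s \<le> F1 t"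
    and sgn: "(\<forall>t\<in>{a..b}. 0 \<le> F2 t) \<or> (\<forall>t\<in>{a..b}. F2 t \<le> 0)"
  shows "integral {a..b} (\<lambda>t. \<bar>F2 t\<bar> / (F1 t)\<^sup>2) \<le> 1 / s"
proof -
  have nz: "F1 t \<noteq> 0" if "t \<in> {a..b}" for t using ge[OF that] s by auto
  have "((\<lambda>t. - inverse (F1 t)) has_real_derivative F2 t / (F1 t)\<^sup>2) (at t)" if "t \<in> {a..b}" for t
    using DERIV_minus[OF DERIV_inverse_fun[OF D1[OF that] nz[OF that]]]
    by (simp add: power2_eq_square field_simps)
  then have I: "((\<lambda>t. F2 t / (F1 t)\<^sup>2) has_integral (- inverse (F1 b) - (- inverse (F1 a)))) {a..b}"
    using ab by (intro fundamental_theorem_of_calculus)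
      (auto simp: has_real_derivative_iff_has_vector_derivative[symmetric] intro: has_field_derivative_at_within)
  have le: "0 \<le> inverse (F1 t)" "inverse (F1 t) \<le> 1 / s" if "t \<in> {a..b}" for t
    using ge[OF that] s by (auto simp: inverse_eq_divide intro!: divide_left_mono)
  from sgn show ?thesis
  proof
    assume pos: "\<forall>t\<in>{a..b}. 0 \<le> F2 t"
    have "integral {a..b} (\<lambda>t. \<bar>F2 t\<bar> / (F1 t)\<^sup>2) = integral {a..b} (\<lambda>t. F2 t / (F1 t)\<^sup>2)"
      by (rule integral_cong) (use pos in auto)
    also have "\<dots> = inverse (F1 a) - inverse (F1 b)"
      using I by (simp add: integral_unique)
    finally show ?thesis using le[of a] le[of b] ab unfolding atLeastAtMost_iff by linarith
  next
    assume neg: "\<forall>t\<in>{a..b}. F2 t \<le> 0"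
    have "integral {a..b} (\<lambda>t. \<bar>F2 t\<bar> / (F1 t)\<^sup>2) = integral {a..b} (\<lambda>t. - (F2 t / (F1 t)\<^sup>2))"
      by (rule integral_cong) (use neg in auto)
    also have "\<dots> = inverse (F1 b) - inverse (F1 a)"
      using I by (simp add: integral_unique)
    finally show ?thesis using le[of a] le[of b] ab unfolding atLeastAtMost_iff by linarith
  qed
qed

definition deriv_seq :: "(nat \<Rightarrow> real \<Rightarrow> real) \<Rightarrow> real set \<Rightarrow> bool" where
  "deriv_seq D S \<longleftrightarrow> (\<forall>j. \<forall>t\<in>S. (D j has_real_derivative D (Suc j) t) (at t))"

lemma deriv_seqD: "deriv_seq D S \<Longrightarrow> t \<in> S \<Longrightarrow> (D j has_real_derivative D (Suc j) t) (at t)"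
  by (simp add: deriv_seq_def)

lemma deriv_seq_subset: "deriv_seq D S \<Longrightarrow> T \<subseteq> S \<Longrightarrow> deriv_seq D T"
  by (auto simp: deriv_seq_def)

lemma deriv_seq_cont: "deriv_seq D S \<Longrightarrow> continuous_on S (D j)"
  unfolding deriv_seq_def by (meson DERIV_isCont continuous_at_imp_continuous_on)

lemma deriv_seq_minus: "deriv_seq D S \<Longrightarrow> deriv_seq (\<lambda>j t. - D j t) S"
  by (auto simp: deriv_seq_def intro: DERIV_minus)

lemma deriv_seq_shift:
  assumes "deriv_seq D S" and "\<And>t. t \<in> T \<Longrightarrow> x + t \<in> S"
  shows "deriv_seq (\<lambda>j t. D j (x + t)) T"
proof (unfold deriv_seq_def, intro allI ballI)
  fix j t assume "t \<in> T"
  then have "(D j has_real_derivative D (Suc j) (x + t)) (at (x + t))"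
    using assms by (auto simp: deriv_seq_def)
  then show "((\<lambda>t. D j (x + t)) has_real_derivative D (Suc j) (x + t)) (at t)"
    by (simp add: DERIV_shift add.commute)
qed

lemma deriv_seq_reflect:
  assumes "deriv_seq D S" and "\<And>t. t \<in> T \<Longrightarrow> - t \<in> S"
  shows "deriv_seq (\<lambda>j t. (-1) ^ j * D j (- t)) T"
proof (unfold deriv_seq_def, intro allI ballI)
  fix j t assume "t \<in> T"
  then have "(D j has_real_derivative D (Suc j) (- t)) (at (- t))"
    using assms by (auto simp: deriv_seq_def)
  then have "((\<lambda>t. D j (- t)) has_real_derivative - D (Suc j) (- t)) (at t)"
    using DERIV_mirror by blast
  from DERIV_cmult[OF this, of "(-1) ^ j"]
  show "((\<lambda>t. (-1) ^ j * D j (- t)) has_real_derivative (-1) ^ Suc j * D (Suc j) (- t)) (at t)"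
    by simp
qed

lemma cis_integrable:
  fixes F :: "real \<Rightarrow> real"
  assumes "continuous_on {a..b} F"
  shows "(\<lambda>t. cis (F t)) integrable_on {a..b}"
  by (intro integrable_continuous_real continuous_intros assms)

lemma norm_integral_cis_le:
  assumes "a \<le> b"
  shows "norm (integral {a..b} (\<lambda>t. cis (F t))) \<le> b - a"
proof (cases "(\<lambda>t. cis (F t)) integrable_on {a..b}")
  case True
  have "norm (integral {a..b} (\<lambda>t. cis (F t))) \<le> integral {a..b} (\<lambda>t. 1)"
    by (rule integral_norm_bound_integral[OF True]) auto
  then show ?thesis using assms by simp
qed (use assms in \<open>simp add: not_integrable_integral\<close>)

lemma integral_cis_minus: "integral S (\<lambda>t. cis (- F t)) = cnj (integral S (\<lambda>t. cis (F t)))"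
proof -
  have "cis (- F t) = cnj (cis (F t))" for t by (simp add: cis_cnj)
  then show ?thesis by (simp add: integral_cnj)
qed

lemma split_at_small_values:
  fixes G :: "real \<Rightarrow> real"
  assumes ab: "a \<le> b" and cont: "continuous_on {a..b} G" and lam: "0 < l" and mu: "0 < m"
    and grow: "\<And>s t. a \<le> s \<Longrightarrow> s \<le> t \<Longrightarrow> t \<le> b \<Longrightarrow> l * (t - s) \<le> G t - G s"
  obtains c d where "a \<le> c" "c \<le> d" "d \<le> b" "l * (d - c) \<le> 2 * m"
    "c = a \<or> (\<forall>t\<in>{a..c}. G t \<le> - m)" "d = b \<or> (\<forall>t\<in>{d..b}. m \<le> G t)"
proof -
  have mono: "G s \<le> G t" if "a \<le> s" "s \<le> t" "t \<le> b" for s t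
    using grow[OF that] mult_nonneg_nonneg[of l "t - s"] lam that by linarith
  consider "G b \<le> - m" | "m \<le> G a" | "- m < G b" "G a < m" by linarith
  then show thesis
  proof cases
    case 1
    show ?thesis by (rule that[of b b]) (use ab mono 1 mu in force)+
  next
    case 2
    show ?thesis by (rule that[of a a]) (use ab mono 2 mu in force)+
  next
    case 3
    obtain c where c: "a \<le> c" "c \<le> b" "- m \<le> G c" "G c < m" "c = a \<or> G c = - m"
    proof (cases "G a \<le> - m")
      case True
      then obtain c where "a \<le> c" "c \<le> b" "G c = - m"
        using IVT'[of G a "-m" b] 3 ab cont by auto
      then show ?thesis using that mu by auto
    qed (use 3 ab that[of a] in auto)
    obtain d where d: "a \<le> d" "d \<le> b" "G d \<le> m" "- m < G d" "d = b \<or> G d = m"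
    proof (cases "m \<le> G b")
      case True
      then obtain d where "a \<le> d" "d \<le> b" "G d = m"
        using IVT'[of G a m b] 3 ab cont by auto
      then show ?thesis using that mu by auto
    qed (use 3 ab that[of b] in auto)
    have cd: "c \<le> d"
    proof (rule ccontr)
      assume "\<not> c \<le> d"
      then have "d < c" by simp
      moreover have "G d \<le> G c" using mono[of d c] c d \<open>d < c\<close> by auto
      ultimately show False using c d mu by auto
    qed
    show ?thesis
    proof (rule that[of c d])
      show "l * (d - c) \<le> 2 * m" using grow[of c d] c d cd by linarith
      show "c = a \<or> (\<forall>t\<in>{a..c}. G t \<le> - m)" using c mono[of _ c] by force
      show "d = b \<or> (\<forall>t\<in>{d..b}. m \<le> G t)" using d mono[of d] by force
    qed (use c d cd in auto)
  qed
qed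

fun vdc_const :: "nat \<Rightarrow> real" where
  "vdc_const 0 = 4"
| "vdc_const (Suc k) = 2 * vdc_const k + 2"

text \<open>The first-derivative case needs a monotone derivative, expressed by a second derivative
  of constant sign.\<close>

lemma van_der_Corput:
  assumes "1 \<le> k" "a \<le> b" "0 < s" "deriv_seq D {a..b}"
    and "\<And>t. t \<in> {a..b} \<Longrightarrow> s ^ k \<le> D k t"
    and "k = 1 \<Longrightarrow> (\<forall>t\<in>{a..b}. 0 \<le> D 2 t) \<or> (\<forall>t\<in>{a..b}. D 2 t \<le> 0)"
  shows "norm (integral {a..b} (\<lambda>t. cis (D 0 t))) \<le> vdc_const k / s"
  using assms
proof (induction k arbitrary: a b D rule: dec_induct)
  case base
  have D: "(D 0 has_real_derivative D 1 t) (at t)" "(D 1 has_real_derivative D 2 t) (at t)"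
    if "t \<in> {a..b}" for t
    using deriv_seqD[OF base(3) that, of 0] deriv_seqD[OF base(3) that, of 1]
    by (simp_all add: numeral_2_eq_2)
  have ge: "s \<le> D 1 t" if "t \<in> {a..b}" for t using base(4)[OF that] by simp
  have "integral {a..b} (\<lambda>t. \<bar>D 2 t\<bar> / (D 1 t)\<^sup>2) \<le> 1 / s"
    using base by (intro integral_derivative_over_square D(2) ge) simp_all
  then have "norm (integral {a..b} (\<lambda>t. cis (D 0 t))) \<le> 2 * (1 / s + 1 / s)"
    by (intro oscillatory_integral_first[OF base(1,2) D deriv_seq_cont[OF base(3)] ge])
  also have "\<dots> \<le> vdc_const 1 / s" using \<open>0 < s\<close> by (simp add: field_simps)
  finally show ?case .
next
  case (step k)
  note ds = step.prems(3)
  have mu: "0 < s ^ k" and lam: "0 < s ^ Suc k" using step.prems by auto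
  have sub: "deriv_seq D {c..d}" if "a \<le> c" "d \<le> b" for c d
    by (rule deriv_seq_subset[OF ds]) (use that in auto)
  have Dpos: "0 \<le> D (Suc k) t" if "t \<in> {a..b}" for t
    using step.prems(4)[OF that] lam by linarith
  have grow: "s ^ Suc k * (v - u) \<le> D k v - D k u" if "a \<le> u" "u \<le> v" "v \<le> b" for u v
  proof (cases "u = v")
    case False
    then have uv: "u < v" using that by simp
    have "(D k has_real_derivative D (Suc k) x) (at x)" if "u \<le> x" "x \<le> v" for x
      using that \<open>a \<le> u\<close> \<open>v \<le> b\<close> by (intro deriv_seqD[OF ds]) auto
    from MVT2[OF uv this] obtain z where z: "u < z" "z < v" "D k v - D k u = (v - u) * D (Suc k) z"
      by blast
    have "(v - u) * s ^ Suc k \<le> (v - u) * D (Suc k) z"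
      using step.prems(4)[of z] z that by (intro mult_left_mono) auto
    then show ?thesis using z by (simp add: mult.commute)
  qed simp
  obtain c d where cd: "a \<le> c" "c \<le> d" "d \<le> b" "s ^ Suc k * (d - c) \<le> 2 * s ^ k"
    "c = a \<or> (\<forall>t\<in>{a..c}. D k t \<le> - (s ^ k))" "d = b \<or> (\<forall>t\<in>{d..b}. s ^ k \<le> D k t)"
    using split_at_small_values[OF step.prems(1) deriv_seq_cont[OF ds] lam mu grow] by blast
  let ?I = "\<lambda>u v. integral {u..v} (\<lambda>t. cis (D 0 t))"
  have C0: "0 \<le> vdc_const j / s" for j
    using \<open>0 < s\<close> by (induction j) (auto simp: field_simps)
  have left: "norm (?I a c) \<le> vdc_const k / s"
  proof (cases "c = a")
    case False
    with cd have "\<forall>t\<in>{a..c}. D k t \<le> - (s ^ k)" by auto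
    then have "norm (integral {a..c} (\<lambda>t. cis (- D 0 t))) \<le> vdc_const k / s"
    proof (intro step.IH[of a c "\<lambda>j t. - D j t"] deriv_seq_minus sub)
      have "- D (Suc k) t \<le> 0" if "t \<in> {a..c}" for t using Dpos[of t] that cd by auto
      then show "(\<forall>t\<in>{a..c}. 0 \<le> - D 2 t) \<or> (\<forall>t\<in>{a..c}. - D 2 t \<le> 0)" if "k = 1"
        using that by (simp add: numeral_2_eq_2)
    next
      fix t assume "t \<in> {a..c}" "\<forall>t\<in>{a..c}. D k t \<le> - (s ^ k)"
      then have "D k t \<le> - (s ^ k)" by blast
      then show "s ^ k \<le> - D k t" by linarith
    qed (use cd step.prems in auto)
    then show ?thesis by (simp add: integral_cis_minus)
  qed (use C0 in simp)
  have right: "norm (?I d b) \<le> vdc_const k / s"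
  proof (cases "d = b")
    case False
    with cd have "\<forall>t\<in>{d..b}. s ^ k \<le> D k t" by auto
    then show ?thesis
    proof (intro step.IH[of d b D] sub)
      have "0 \<le> D (Suc k) t" if "t \<in> {d..b}" for t using Dpos[of t] that cd by auto
      then show "(\<forall>t\<in>{d..b}. 0 \<le> D 2 t) \<or> (\<forall>t\<in>{d..b}. D 2 t \<le> 0)" if "k = 1"
        using that by (simp add: numeral_2_eq_2)
    qed (use cd step.prems in auto)
  qed (use C0 in simp)
  have "s ^ k * (s * (d - c)) \<le> s ^ k * 2" using cd(4) by (simp add: mult_ac)
  then have "s * (d - c) \<le> 2" using mu by (simp add: mult_le_cancel_left_pos)
  then have "d - c \<le> 2 / s" using \<open>0 < s\<close> by (simp add: field_simps)
  then have mid: "norm (?I c d) \<le> 2 / s"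
    by (rule order_trans[OF norm_integral_cis_le[OF cd(2)]])
  have int: "(\<lambda>t. cis (D 0 t)) integrable_on {u..v}" if "a \<le> u" "v \<le> b" for u v
    by (rule cis_integrable[OF deriv_seq_cont[OF sub[OF that]]])
  have "?I a b = ?I a c + (?I c d + ?I d b)"
    using cd int by (simp add: Henstock_Kurzweil_Integration.integral_combine)
  then have "norm (?I a b) \<le> norm (?I a c) + (norm (?I c d) + norm (?I d b))"
    by (simp add: norm_triangle_le norm_triangle_ineq)
  also have "\<dots> \<le> vdc_const (Suc k) / s"
    using left mid right by (simp add: add_divide_distrib)
  finally show ?case .
qed

lemma van_der_Corput_abs:
  assumes "1 \<le> k" "a \<le> b" "0 < s" "deriv_seq D {a..b}"
    and sgn: "(\<forall>t\<in>{a..b}. s ^ k \<le> D k t) \<or> (\<forall>t\<in>{a..b}. D k t \<le> - (s ^ k))"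
    and "k \<noteq> 1"
  shows "norm (integral {a..b} (\<lambda>t. cis (D 0 t))) \<le> vdc_const k / s"
  using sgn
proof
  assume "\<forall>t\<in>{a..b}. s ^ k \<le> D k t"
  then show ?thesis using assms by (intro van_der_Corput) auto
next
  assume neg: "\<forall>t\<in>{a..b}. D k t \<le> - (s ^ k)"
  have "norm (integral {a..b} (\<lambda>t. cis (- D 0 t))) \<le> vdc_const k / s"
  proof (rule van_der_Corput[of k a b s "\<lambda>j t. - D j t"])
    fix t assume "t \<in> {a..b}"
    with neg have "D k t \<le> - (s ^ k)" by blast
    then show "s ^ k \<le> - D k t" by linarith
  qed (use assms in \<open>auto intro: deriv_seq_minus\<close>)
  then show ?thesis by (simp add: integral_cis_minus)
qed

lemma van_der_Corput_first_bounded: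
  assumes ab: "a \<le> b" and s: "0 < s" and ds: "deriv_seq D {a..b}"
    and sgn: "(\<forall>t\<in>{a..b}. s \<le> D 1 t) \<or> (\<forall>t\<in>{a..b}. D 1 t \<le> - s)"
    and K: "\<And>t. t \<in> {a..b} \<Longrightarrow> \<bar>D 2 t\<bar> \<le> K"
  shows "norm (integral {a..b} (\<lambda>t. cis (D 0 t))) \<le> 2 * (1 / s + (b - a) * K / s\<^sup>2)"
proof -
  have *: "norm (integral {a..b} (\<lambda>t. cis (E 0 t))) \<le> 2 * (1 / s + (b - a) * K / s\<^sup>2)"
    if E: "deriv_seq E {a..b}" and ge: "\<And>t. t \<in> {a..b} \<Longrightarrow> s \<le> E 1 t"
      and K: "\<And>t. t \<in> {a..b} \<Longrightarrow> \<bar>E 2 t\<bar> \<le> K" for E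
  proof -
    have D: "(E 0 has_real_derivative E 1 t) (at t)" "(E 1 has_real_derivative E 2 t) (at t)"
      if "t \<in> {a..b}" for t
      using deriv_seqD[OF E that, of 0] deriv_seqD[OF E that, of 1]
      by (simp_all add: numeral_2_eq_2)
    have pos: "0 < E 1 t" if "t \<in> {a..b}" for t using ge[OF that] s by simp
    have "integral {a..b} (\<lambda>t. \<bar>E 2 t\<bar> / (E 1 t)\<^sup>2) \<le> integral {a..b} (\<lambda>t. K / s\<^sup>2)"
    proof (rule integral_le)
      show "(\<lambda>t. \<bar>E 2 t\<bar> / (E 1 t)\<^sup>2) integrable_on {a..b}"
        using pos by (intro integrable_continuous_real continuous_intros deriv_seq_cont[OF E]) force
      fix t assume t: "t \<in> {a..b}"
      have "0 \<le> K" using K[OF t] by linarith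
      then show "\<bar>E 2 t\<bar> / (E 1 t)\<^sup>2 \<le> K / s\<^sup>2"
        using K[OF t] ge[OF t] s by (intro frac_le power_mono) auto
    qed (rule integrable_const_ivl)
    also have "\<dots> = (b - a) * K / s\<^sup>2" using ab by simp
    finally show ?thesis
      by (intro oscillatory_integral_first[OF ab s D deriv_seq_cont[OF E] ge])
  qed
  from sgn show ?thesis
  proof
    assume "\<forall>t\<in>{a..b}. s \<le> D 1 t"
    then show ?thesis using K by (intro * ds) auto
  next
    assume neg: "\<forall>t\<in>{a..b}. D 1 t \<le> - s"
    have "norm (integral {a..b} (\<lambda>t. cis (- D 0 t))) \<le> 2 * (1 / s + (b - a) * K / s\<^sup>2)"
      by (rule *[OF deriv_seq_minus[OF ds]]) (use neg K in force)+
    then show ?thesis by (simp add: integral_cis_minus)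
  qed
qed

definition osc :: "(real \<Rightarrow> real) \<Rightarrow> real \<Rightarrow> real \<Rightarrow> complex" where
  "osc F a b = integral {a..b} (\<lambda>t. (cis (F t) - cis (F (- t))) / of_real t)"

lemma continuous_on_uminus_arg:
  fixes F :: "real \<Rightarrow> 'a::topological_space"
  assumes "continuous_on {-b..b} F" "S \<subseteq> {-b..b}"
  shows "continuous_on S (\<lambda>t. F (- t))"
  by (rule continuous_on_compose2[OF assms(1)]) (use assms(2) in \<open>auto intro!: continuous_intros\<close>)

lemma osc_integrable:
  assumes "0 < a" and F: "continuous_on {-b..b} F"
  shows "(\<lambda>t. (cis (F t) - cis (F (- t))) / complex_of_real t) integrable_on {a..b}"
  using assms(1)
  by (intro integrable_continuous_real continuous_intros continuous_on_subset[OF F]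
      continuous_on_uminus_arg[OF F]) auto

lemma osc_combine:
  assumes "0 < a" "a \<le> r" "r \<le> b" "continuous_on {-b..b} F"
  shows "osc F a b = osc F a r + osc F r b"
  unfolding osc_def
  using assms by (subst Henstock_Kurzweil_Integration.integral_combine[of a r b]) (auto intro: osc_integrable)

lemma norm_osc_split_le:
  assumes "0 < a" "a \<le> r" "r \<le> b" "continuous_on {-b..b} F"
  shows "norm (osc F a b) \<le> norm (osc F a r) + norm (osc F r b)"
  using osc_combine[OF assms] norm_triangle_ineq[of "osc F a r" "osc F r b"] by simp

lemma norm_cis_diff_le: "norm (cis x - cis y) \<le> \<bar>x - y\<bar>"
proof -
  have "norm (cis x - cis y) \<le> 1 * norm (x - y)"
  proof (rule differentiable_bound)
    fix t :: real assume "t \<in> UNIV"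
    show "(cis has_derivative (\<lambda>h. h *\<^sub>R (\<i> * cis t))) (at t within UNIV)"
      using has_derivative_cis[of "\<lambda>t. t" "\<lambda>h. h" t UNIV] by simp
    show "onorm (\<lambda>h. h *\<^sub>R (\<i> * cis t)) \<le> 1"
      by (rule onorm_le) (simp add: norm_mult)
  qed auto
  then show ?thesis by simp
qed

lemma osc_diff_le:
  assumes a: "0 < a" "a \<le> b" and m: "1 \<le> m"
    and F: "continuous_on {-b..b} F" and Q: "continuous_on {-b..b} Q"
    and le: "\<And>t. \<bar>t\<bar> \<le> b \<Longrightarrow> \<bar>F t - Q t\<bar> \<le> A * \<bar>t\<bar> ^ m"
  shows "norm (osc F a b - osc Q a b) \<le> 2 * A * b ^ m"
proof -
  have A0: "0 \<le> A" using le[of b] a by (smt (verit) zero_le_mult_iff zero_less_power)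
  have "osc F a b - osc Q a b = integral {a..b}
      (\<lambda>t. (cis (F t) - cis (F (- t))) / of_real t - (cis (Q t) - cis (Q (- t))) / of_real t)"
    unfolding osc_def by (intro integral_diff[symmetric] osc_integrable a F Q)
  also have "norm \<dots> \<le> integral {a..b} (\<lambda>t. 2 * A * b ^ (m - 1))"
  proof (rule integral_norm_bound_integral)
    fix t assume t: "t \<in> {a..b}"
    then have t0: "0 < t" using a by auto
    have "norm ((cis (F t) - cis (F (- t))) / of_real t - (cis (Q t) - cis (Q (- t))) / of_real t)
        = norm ((cis (F t) - cis (Q t)) - (cis (F (- t)) - cis (Q (- t)))) / t"
      using t0 by (simp add: norm_divide algebra_simps flip: diff_divide_distrib)
    also have "\<dots> \<le> (A * t ^ m + A * t ^ m) / t"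
    proof (rule divide_right_mono)
      have "norm (cis (F t) - cis (Q t)) \<le> A * t ^ m"
        using order_trans[OF norm_cis_diff_le le[of t]] t t0 by simp
      moreover have "norm (cis (F (-t)) - cis (Q (-t))) \<le> A * t ^ m"
        using order_trans[OF norm_cis_diff_le le[of "-t"]] t t0 by simp
      ultimately show "norm ((cis (F t) - cis (Q t)) - (cis (F (- t)) - cis (Q (- t)))) \<le> A * t ^ m + A * t ^ m"
        by (rule order_trans[OF norm_triangle_ineq4 add_mono])
    qed (use t0 in simp)
    also have "\<dots> = 2 * A * t ^ (m - 1)"
      using t0 m by (cases m) (auto simp: field_simps)
    also have "\<dots> \<le> 2 * A * b ^ (m - 1)"
      using t t0 A0 by (intro mult_left_mono power_mono) auto
    finally show "norm ((cis (F t) - cis (F (- t))) / of_real t - (cis (Q t) - cis (Q (- t))) / of_real t)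
        \<le> 2 * A * b ^ (m - 1)" .
  qed (auto intro!: integrable_diff osc_integrable a F Q)
  also have "\<dots> = 2 * A * b ^ (m - 1) * (b - a)" using a by simp
  also have "\<dots> \<le> 2 * A * b ^ (m - 1) * b"
    using a A0 by (intro mult_left_mono) auto
  also have "\<dots> = 2 * A * b ^ m" using m by (cases m) auto
  finally show ?thesis .
qed

lemma integral_inverse_weight_le:
  fixes u :: "real \<Rightarrow> complex"
  assumes r: "0 < r" "r \<le> b" and u: "continuous_on {r..b} u"
    and B: "\<And>s. s \<in> {r..b} \<Longrightarrow> norm (integral {r..s} u) \<le> B"
  shows "norm (integral {r..b} (\<lambda>t. u t / of_real t)) \<le> B / r"
proof -
  have I: "((\<lambda>t. inverse (t\<^sup>2)) has_integral (- inverse b - (- inverse r))) {r..b}"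
  proof (rule fundamental_theorem_of_calculus[OF r(2)])
    fix t assume t: "t \<in> {r..b}"
    then have "t \<noteq> 0" using r by auto
    then have "((\<lambda>t. - inverse t) has_real_derivative inverse (t\<^sup>2)) (at t)"
      by (auto intro!: derivative_eq_intros simp: power2_eq_square)
    then show "((\<lambda>t. - inverse t) has_vector_derivative inverse (t\<^sup>2)) (at t within {r..b})"
      using has_real_derivative_iff_has_vector_derivative has_vector_derivative_at_within by blast
  qed
  have "norm (integral {r..b} (\<lambda>t. of_real (inverse t) * u t))
      \<le> B * (norm (complex_of_real (inverse b)) + integral {r..b} (\<lambda>t. inverse (t\<^sup>2)))"
  proof (rule weighted_integral_bound[OF r(2) u B])
    fix t assume t: "t \<in> {r..b}"
    then have "t \<noteq> 0" using r by auto
    then have "(inverse has_real_derivative - inverse (t\<^sup>2)) (at t)"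
      by (auto intro!: derivative_eq_intros simp: power2_eq_square)
    then show "((\<lambda>t. complex_of_real (inverse t)) has_vector_derivative of_real (- inverse (t\<^sup>2))) (at t)"
      by (intro has_vector_derivative_of_real) (simp add: has_real_derivative_iff_has_vector_derivative)
  next
    show "continuous_on {r..b} (\<lambda>t. complex_of_real (- inverse (t\<^sup>2)))"
      using r by (intro continuous_intros) auto
  qed (use I in \<open>auto simp: integrable_on_def norm_inverse norm_power\<close>)
  also have "\<dots> = B / r" using r I by (simp add: integral_unique norm_inverse norm_divide inverse_eq_divide)
  finally show ?thesis by (simp add: divide_inverse mult.commute)
qed

lemma osc_tail:
  assumes r: "0 < r" "r \<le> b" and F: "continuous_on {-b..b} F"
    and B: "\<And>s. s \<in> {r..b} \<Longrightarrow> norm (integral {r..s} (\<lambda>t. cis (F t))) \<le> B"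
    and B': "\<And>s. s \<in> {r..b} \<Longrightarrow> norm (integral {r..s} (\<lambda>t. cis (F (- t)))) \<le> B"
  shows "norm (osc F r b) \<le> 2 * B / r"
proof -
  have c: "continuous_on {r..b} (\<lambda>t. cis (F t))" "continuous_on {r..b} (\<lambda>t. cis (F (- t)))"
    using r by (auto intro!: continuous_intros continuous_on_subset[OF F] continuous_on_uminus_arg[OF F])
  have i: "(\<lambda>t. cis (F t) / of_real t) integrable_on {r..b}" "(\<lambda>t. cis (F (- t)) / of_real t) integrable_on {r..b}"
    using r by (auto intro!: integrable_continuous_real continuous_intros c)
  have "osc F r b = integral {r..b} (\<lambda>t. cis (F t) / of_real t) - integral {r..b} (\<lambda>t. cis (F (- t)) / of_real t)"
    unfolding osc_def diff_divide_distrib by (rule integral_diff[OF i])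
  also have "norm \<dots> \<le> B / r + B / r"
    by (intro order_trans[OF norm_triangle_ineq4] add_mono integral_inverse_weight_le r c B B')
  finally show ?thesis by simp
qed

lemma vdc_const_nonneg: "0 \<le> vdc_const k"
  by (induction k) auto

lemma osc_tail_van_der_Corput:
  assumes r: "0 < r" "r \<le> b" and ds: "deriv_seq D {-b..b}" and k: "1 \<le> k" and s: "0 < s"
    and sgn: "(\<forall>t\<in>{-b..b}. s ^ k \<le> D k t) \<or> (\<forall>t\<in>{-b..b}. D k t \<le> - (s ^ k))"
    and K: "\<And>t. k = 1 \<Longrightarrow> t \<in> {-b..b} \<Longrightarrow> b * \<bar>D 2 t\<bar> \<le> K * s" and K0: "0 \<le> K"
  shows "norm (osc (D 0) r b) \<le> 2 * (vdc_const k + 2 + 2 * K) / (s * r)"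
proof -
  have *: "norm (integral {r..v} (\<lambda>t. cis (E 0 t))) \<le> (vdc_const k + 2 + 2 * K) / s"
    if E: "deriv_seq E {-b..b}" and sgn: "(\<forall>t\<in>{-b..b}. s ^ k \<le> E k t) \<or> (\<forall>t\<in>{-b..b}. E k t \<le> - (s ^ k))"
      and K: "\<And>t. k = 1 \<Longrightarrow> t \<in> {-b..b} \<Longrightarrow> b * \<bar>E 2 t\<bar> \<le> K * s" and v: "v \<in> {r..b}" for E v
  proof -
    have sub: "{r..v} \<subseteq> {-b..b}" using v r by auto
    have E': "deriv_seq E {r..v}" using deriv_seq_subset[OF E sub] .
    have sgn': "(\<forall>t\<in>{r..v}. s ^ k \<le> E k t) \<or> (\<forall>t\<in>{r..v}. E k t \<le> - (s ^ k))"
      using sgn sub by blast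
    show ?thesis
    proof (cases "k = 1")
      case True
      have b0: "0 < b" using r by simp
      have "norm (integral {r..v} (\<lambda>t. cis (E 0 t))) \<le> 2 * (1 / s + (v - r) * (K * s / b) / s\<^sup>2)"
      proof (rule van_der_Corput_first_bounded[OF _ s E'])
        fix t assume "t \<in> {r..v}"
        then have "b * \<bar>E 2 t\<bar> \<le> K * s" using K[OF True] sub by blast
        then show "\<bar>E 2 t\<bar> \<le> K * s / b" using b0 by (simp add: field_simps)
      qed (use sgn' True v in auto)
      also have "(v - r) * (K * s / b) / s\<^sup>2 = ((v - r) / b) * (K / s)"
        using s by (simp add: power2_eq_square)
      also have "\<dots> \<le> 1 * (K / s)"
        using v r b0 s K0 by (intro mult_right_mono) (auto simp: field_simps)
      also have "2 * (1 / s + 1 * (K / s)) \<le> (vdc_const k + 2 + 2 * K) / s"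
        using s vdc_const_nonneg[of k] by (simp add: field_simps)
      finally show ?thesis by simp
    next
      case False
      have "norm (integral {r..v} (\<lambda>t. cis (E 0 t))) \<le> vdc_const k / s"
        using v k s E' sgn' False by (intro van_der_Corput_abs) auto
      also have "\<dots> \<le> (vdc_const k + 2 + 2 * K) / s"
        using s K0 by (intro divide_right_mono) auto
      finally show ?thesis .
    qed
  qed
  have "norm (osc (D 0) r b) \<le> 2 * ((vdc_const k + 2 + 2 * K) / s) / r"
  proof (rule osc_tail[OF r deriv_seq_cont[OF ds]])
    fix v assume v: "v \<in> {r..b}"
    show "norm (integral {r..v} (\<lambda>t. cis (D 0 t))) \<le> (vdc_const k + 2 + 2 * K) / s"
      by (rule *[OF ds sgn K v])
    have "norm (integral {r..v} (\<lambda>t. cis ((-1) ^ 0 * D 0 (- t)))) \<le> (vdc_const k + 2 + 2 * K) / s"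
    proof (rule *[OF deriv_seq_reflect[OF ds]])
      have D: "(\<forall>t\<in>{-b..b}. s ^ k \<le> D k (- t)) \<or> (\<forall>t\<in>{-b..b}. D k (- t) \<le> - (s ^ k))"
        using sgn by (metis atLeastAtMost_iff minus_le_iff neg_le_iff_le)
      show "(\<forall>t\<in>{-b..b}. s ^ k \<le> (-1) ^ k * D k (- t)) \<or> (\<forall>t\<in>{-b..b}. (-1) ^ k * D k (- t) \<le> - (s ^ k))"
      proof (cases "even k")
        case False
        show ?thesis using D
        proof
          assume "\<forall>t\<in>{-b..b}. s ^ k \<le> D k (- t)"
          then show ?thesis using False by simp
        next
          assume "\<forall>t\<in>{-b..b}. D k (- t) \<le> - (s ^ k)"
          then have "\<forall>t\<in>{-b..b}. s ^ k \<le> - D k (- t)" by force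
          then show ?thesis using False by simp
        qed
      qed (use D in simp)
    qed (use v K[of "- t" for t] in auto)
    then show "norm (integral {r..v} (\<lambda>t. cis (D 0 (- t)))) \<le> (vdc_const k + 2 + 2 * K) / s" by simp
  qed
  then show ?thesis by simp
qed

lemma poly_deriv_seq: "deriv_seq (\<lambda>j. poly ((pderiv ^^ j) p)) S"
  by (auto simp: deriv_seq_def poly_DERIV)

text \<open>Induction on the degree: below the scale at which the leading term reaches size one it may
  be dropped, beyond that scale the bound of van der Corput applies.\<close>

lemma Stein_Wainger:
  "\<exists>A\<ge>0. \<forall>p. degree p \<le> m \<longrightarrow> (\<forall>a b. 0 < a \<longrightarrow> a \<le> b \<longrightarrow> norm (osc (poly p) a b) \<le> A)"
proof (induction m)
  case 0
  have "osc (poly p) a b = 0" if "degree p \<le> 0" for p a b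
    using that by (auto elim!: degree_eq_zeroE simp: osc_def)
  then show ?case by (intro exI[of _ 0]) auto
next
  case (Suc m)
  then obtain A where A0: "0 \<le> A"
    and A: "\<And>p a b. degree p \<le> m \<Longrightarrow> 0 < a \<Longrightarrow> a \<le> b \<Longrightarrow> norm (osc (poly p) a b) \<le> A" by blast
  define A' where "A' = A + 2 + 2 * (vdc_const (Suc m) + 2)"
  have V0: "0 \<le> vdc_const (Suc m)" by (rule vdc_const_nonneg)
  show ?case
  proof (intro exI[of _ A'] conjI allI impI)
    show "0 \<le> A'" using A0 V0 by (simp add: A'_def)
    fix p :: "real poly" and a b :: real
    assume deg: "degree p \<le> Suc m" and a: "0 < a" "a \<le> b"
    define c where "c = coeff p (Suc m)"
    define q where "q = p - monom c (Suc m)"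
    have "degree q \<le> Suc m" unfolding q_def using deg by (intro degree_diff_le degree_monom_le)
    moreover have "coeff q (Suc m) = 0" by (simp add: q_def c_def)
    ultimately have degq: "degree q \<le> m"
      by (metis le_SucE leading_coeff_0_iff degree_0 zero_le)
    show "norm (osc (poly p) a b) \<le> A'"
    proof (cases "c = 0")
      case True
      then have "degree p \<le> m" using degq by (simp add: q_def)
      then have "norm (osc (poly p) a b) \<le> A" using A a by blast
      then show ?thesis using V0 by (simp add: A'_def)
    next
      case False
      define \<rho> where "\<rho> = root (Suc m) (1 / \<bar>c\<bar>)"
      have \<rho>: "0 < \<rho>" "\<rho> ^ Suc m = 1 / \<bar>c\<bar>"
        using False by (simp_all add: \<rho>_def real_root_pow_pos2 del: power_Suc)
      define r where "r = max a (min b \<rho>)"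
      have r: "0 < r" "a \<le> r" "r \<le> b" using a \<rho> by (auto simp: r_def)
      have "norm (osc (poly p) a r) \<le> A + 2"
      proof (cases "r = a")
        case True
        then show ?thesis using A0 by (simp add: osc_def)
      next
        case False
        then have "r \<le> \<rho>" by (auto simp: r_def)
        then have "r ^ Suc m \<le> 1 / \<bar>c\<bar>" unfolding \<rho>(2)[symmetric] using r by (intro power_mono) auto
        then have "\<bar>c\<bar> * r ^ Suc m \<le> 1" using \<open>c \<noteq> 0\<close> by (simp add: field_simps)
        moreover have "norm (osc (poly p) a r - osc (poly q) a r) \<le> 2 * \<bar>c\<bar> * r ^ Suc m"
          by (rule osc_diff_le)
            (use a r in \<open>auto intro!: continuous_intros simp: q_def poly_monom abs_mult power_abs\<close>)
        ultimately have "norm (osc (poly p) a r - osc (poly q) a r) \<le> 2" by linarith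
        moreover have "norm (osc (poly q) a r) \<le> A" using A degq a r by blast
        ultimately show ?thesis using norm_triangle_sub[of "osc (poly p) a r" "osc (poly q) a r"] by linarith
      qed
      moreover have "norm (osc (poly p) r b) \<le> 2 * (vdc_const (Suc m) + 2)"
      proof (cases "r = b")
        case True
        then show ?thesis using V0 by (simp add: osc_def)
      next
        case False
        then have "\<rho> \<le> r" using a by (auto simp: r_def)
        let ?D = "\<lambda>j. poly ((pderiv ^^ j) p)"
        have hi: "coeff ((pderiv ^^ j) p) n = 0" if "Suc m < n + j" for j n
          using that deg by (simp add: coeff_higher_pderiv coeff_eq_0)
        have const: "?D (Suc m) t = fact (Suc m) * c" for t
        proof -
          have "(pderiv ^^ Suc m) p = [:coeff ((pderiv ^^ Suc m) p) 0:]"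
            by (rule poly_eqI) (use hi[of _ "Suc m"] in \<open>auto simp: coeff_pCons split: nat.splits simp del: funpow.simps\<close>)
          also have "coeff ((pderiv ^^ Suc m) p) 0 = fact (Suc m) * c"
            by (simp add: coeff_higher_pderiv c_def pochhammer_fact[symmetric] del: funpow.simps fact_Suc)
          finally show ?thesis by (simp only: poly_pCons poly_0 mult_zero_right add_0_right)
        qed
        have f: "1 \<le> (fact (Suc m) :: real)" by (rule fact_ge_1)
        have "norm (osc (?D 0) r b) \<le> 2 * (vdc_const (Suc m) + 2 + 2 * 0) / (1 / \<rho> * r)"
        proof (rule osc_tail_van_der_Corput[OF r(1,3) poly_deriv_seq])
          have s: "(1 / \<rho>) ^ Suc m = \<bar>c\<bar>" unfolding power_divide \<rho>(2) by simp
          have "\<bar>c\<bar> \<le> \<bar>fact (Suc m) * c\<bar>"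
            unfolding abs_mult using mult_right_mono[OF f, of "\<bar>c\<bar>"] by simp
          then have "\<bar>c\<bar> \<le> fact (Suc m) * c \<or> fact (Suc m) * c \<le> - \<bar>c\<bar>" by linarith
          then show "(\<forall>t\<in>{-b..b}. (1 / \<rho>) ^ Suc m \<le> ?D (Suc m) t) \<or> (\<forall>t\<in>{-b..b}. ?D (Suc m) t \<le> - ((1 / \<rho>) ^ Suc m))"
            unfolding const s by blast
        next
          fix t assume "Suc m = 1"
          then have "(pderiv ^^ 2) p = 0" by (intro poly_eqI) (use hi in auto)
          then show "b * \<bar>?D 2 t\<bar> \<le> 0 * (1 / \<rho>)" by simp
        qed (use \<rho> in auto)
        also have "\<dots> \<le> 2 * (vdc_const (Suc m) + 2)"
        proof -
          have "1 \<le> 1 / \<rho> * r" using \<open>\<rho> \<le> r\<close> \<rho>(1) by (simp add: field_simps)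
          then have "2 * (vdc_const (Suc m) + 2) / (1 / \<rho> * r) \<le> 2 * (vdc_const (Suc m) + 2) / 1"
            using V0 by (intro divide_left_mono) auto
          then show ?thesis by simp
        qed
        finally show ?thesis by simp
      qed
      moreover have "norm (osc (poly p) a b) \<le> norm (osc (poly p) a r) + norm (osc (poly p) r b)"
        by (rule norm_osc_split_le[OF a(1) r(2,3)]) (intro continuous_intros)
      ultimately show ?thesis
        unfolding A'_def by linarith
    qed
  qed
qed

lemma osc_finite_type_bounded:
  assumes m: "1 \<le> m" and K: "1 \<le> K" and c: "0 < c" "c \<le> 1" and \<delta>: "0 < \<delta>" "\<delta> \<le> 1"
  shows "\<exists>C. \<forall>D l k e. deriv_seq D {-\<delta>..\<delta>} \<longrightarrow> 0 \<le> l \<longrightarrow> 1 \<le> k \<longrightarrow> k \<le> m \<longrightarrow>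
    (\<forall>t\<in>{-\<delta>..\<delta>}. \<bar>D 1 t\<bar> \<le> K * l \<and> \<bar>D 2 t\<bar> \<le> K * l \<and> \<bar>D (Suc m) t\<bar> \<le> K * l) \<longrightarrow>
    (\<forall>t\<in>{-\<delta>..\<delta>}. c * l \<le> D k t) \<or> (\<forall>t\<in>{-\<delta>..\<delta>}. D k t \<le> - (c * l)) \<longrightarrow>
    0 < e \<longrightarrow> e \<le> \<delta> \<longrightarrow> norm (osc (D 0) e \<delta>) \<le> C"
proof -
  obtain A where A0: "0 \<le> A"
    and A: "\<And>p a b. degree p \<le> m \<Longrightarrow> 0 < a \<Longrightarrow> a \<le> b \<Longrightarrow> norm (osc (poly p) a b) \<le> A"
    using Stein_Wainger[of m] by blast
  define V where "V = (\<Sum>k\<le>m. vdc_const k)"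
  have V: "vdc_const k \<le> V" if "k \<le> m" for k
    unfolding V_def using that by (intro member_le_sum) (auto simp: vdc_const_nonneg)
  have V0: "0 \<le> V" unfolding V_def by (intro sum_nonneg vdc_const_nonneg)
  define B where "B = 2 * (V + 2 + 2 * (K / c)) / (c / K)"
  have B0: "0 \<le> B" unfolding B_def using V0 K c by auto
  define C where "C = A + 2 + B + 2 * K"
  have "norm (osc (D 0) e \<delta>) \<le> C"
    if ds: "deriv_seq D {-\<delta>..\<delta>}" and l: "0 \<le> l" and k: "1 \<le> k" "k \<le> m"
      and bd: "\<And>t. t \<in> {-\<delta>..\<delta>} \<Longrightarrow> \<bar>D 1 t\<bar> \<le> K * l"
        "\<And>t. t \<in> {-\<delta>..\<delta>} \<Longrightarrow> \<bar>D 2 t\<bar> \<le> K * l"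
        "\<And>t. t \<in> {-\<delta>..\<delta>} \<Longrightarrow> \<bar>D (Suc m) t\<bar> \<le> K * l"
      and sgn: "(\<forall>t\<in>{-\<delta>..\<delta>}. c * l \<le> D k t) \<or> (\<forall>t\<in>{-\<delta>..\<delta>}. D k t \<le> - (c * l))"
      and e: "0 < e" "e \<le> \<delta>" for D l k e
  proof -
    have taylor: "\<bar>D 0 t - (\<Sum>i<n. D i 0 / fact i * t ^ i)\<bar> \<le> K * l * \<bar>t\<bar> ^ n"
      if b: "\<And>t. t \<in> {-\<delta>..\<delta>} \<Longrightarrow> \<bar>D n t\<bar> \<le> K * l" and t: "\<bar>t\<bar> \<le> \<delta>" for n t
    proof -
      have "\<forall>i s. i < n \<and> \<bar>s\<bar> \<le> \<bar>t\<bar> \<longrightarrow> (D i has_real_derivative D (Suc i) s) (at s)"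
        using t by (auto intro!: deriv_seqD[OF ds])
      from Maclaurin_bi_le[of D "D 0", OF refl this]
      obtain s where s: "\<bar>s\<bar> \<le> \<bar>t\<bar>"
        "D 0 t = (\<Sum>i<n. D i 0 / fact i * t ^ i) + D n s / fact n * t ^ n" by blast
      have "\<bar>D 0 t - (\<Sum>i<n. D i 0 / fact i * t ^ i)\<bar> = \<bar>D n s\<bar> / fact n * \<bar>t\<bar> ^ n"
        using s(2) by (simp add: abs_mult power_abs)
      also have "\<dots> \<le> K * l / 1 * \<bar>t\<bar> ^ n"
      proof (intro mult_right_mono frac_le)
        show "\<bar>D n s\<bar> \<le> K * l" by (rule b) (use s(1) t in auto)
      qed (use K l fact_ge_1[of n] in auto)
      finally show ?thesis by simp
    qed
    have cont: "continuous_on {-\<delta>..\<delta>} (D 0)" by (rule deriv_seq_cont[OF ds])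
    show ?thesis
    proof (cases "l \<le> 1")
      case True
      have "norm (osc (D 0) e \<delta> - osc (\<lambda>_. D 0 0) e \<delta>) \<le> 2 * (K * l) * \<delta> ^ 1"
        by (rule osc_diff_le[OF e _ cont]) (use taylor[of 1] bd in \<open>auto\<close>)
      also have "\<dots> \<le> 2 * (K * 1) * 1"
        using K l True \<delta> by (intro mult_mono) auto
      finally have "norm (osc (D 0) e \<delta>) \<le> 2 * K" by (simp add: osc_def)
      then show ?thesis using A0 B0 by (simp add: C_def)
    next
      case False
      define \<tau> where "\<tau> = root (Suc m) (1 / l)"
      have \<tau>: "0 < \<tau>" "\<tau> \<le> 1" "\<tau> ^ Suc m = 1 / l"
        using False by (simp_all add: \<tau>_def real_root_pow_pos2 del: power_Suc)
      have l\<tau>: "l = (1 / \<tau>) ^ Suc m" unfolding power_divide \<tau>(3) using False by simp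
      have i\<tau>: "1 \<le> 1 / \<tau>" using \<tau> by simp
      define r where "r = max e (min \<delta> (\<tau> / K))"
      have r: "0 < r" "e \<le> r" "r \<le> \<delta>" using e \<tau> K by (auto simp: r_def)
      have "norm (osc (D 0) e r) \<le> A + 2"
      proof (cases "r = e")
        case True
        then show ?thesis using A0 by (simp add: osc_def)
      next
        case False
        then have "r \<le> \<tau> / K" by (auto simp: r_def)
        then have "r ^ Suc m \<le> (\<tau> / K) ^ Suc m" using r by (intro power_mono) auto
        then have "K * l * r ^ Suc m \<le> K * l * (\<tau> / K) ^ Suc m"
          using K l by (intro mult_left_mono) auto
        also have "\<dots> = K / K ^ Suc m" unfolding power_divide \<tau>(3) using \<open>\<not> l \<le> 1\<close> by simp
        also have "\<dots> = 1 / K ^ m" using K by simp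
        also have "\<dots> \<le> 1" using one_le_power[OF K, of m] by (simp add: field_simps)
        finally have small: "K * l * r ^ Suc m \<le> 1" .
        define q where "q = (\<Sum>i<Suc m. monom (D i 0 / fact i) i)"
        have q: "poly q t = (\<Sum>i<Suc m. D i 0 / fact i * t ^ i)" for t
          unfolding q_def poly_sum poly_monom ..
        have degq: "degree q \<le> m" unfolding q_def
          by (intro degree_sum_le order_trans[OF degree_monom_le]) auto
        have "norm (osc (D 0) e r - osc (poly q) e r) \<le> 2 * (K * l) * r ^ Suc m"
        proof (rule osc_diff_le[OF e(1) r(2)])
          show "continuous_on {-r..r} (D 0)" by (rule continuous_on_subset[OF cont]) (use r in auto)
          show "\<bar>D 0 t - poly q t\<bar> \<le> K * l * \<bar>t\<bar> ^ Suc m" if "\<bar>t\<bar> \<le> r" for t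
            unfolding q by (rule taylor) (use bd(3) that r in auto)
        qed (auto intro: continuous_intros)
        then have "norm (osc (D 0) e r - osc (poly q) e r) \<le> 2" using small by linarith
        moreover have "norm (osc (poly q) e r) \<le> A" using A degq e r by blast
        ultimately show ?thesis using norm_triangle_sub[of "osc (D 0) e r" "osc (poly q) e r"] by linarith
      qed
      moreover have "norm (osc (D 0) r \<delta>) \<le> B"
      proof (cases "r = \<delta>")
        case True
        then show ?thesis using B0 by (simp add: osc_def)
      next
        case False
        then have "\<tau> / K \<le> r" using e by (auto simp: r_def)
        define s where "s = (if k = 1 then c * l else c / \<tau>)"
        have s0: "0 < s" using c \<tau> \<open>\<not> l \<le> 1\<close> by (auto simp: s_def)
        have pw: "(1 / \<tau>) ^ k \<le> l" unfolding l\<tau> using i\<tau> k by (intro power_increasing) auto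
        have sk: "s ^ k \<le> c * l"
        proof (cases "k = 1")
          case False
          have "s ^ k = c ^ k * (1 / \<tau>) ^ k" using False by (simp add: s_def power_divide)
          also have "\<dots> \<le> c * l"
            using pw c k \<tau> power_decreasing[of 1 k c] by (intro mult_mono) auto
          finally show ?thesis .
        qed (simp add: s_def)
        have "1 / \<tau> \<le> l" unfolding l\<tau> using power_increasing[OF _ i\<tau>, of 1 "Suc m"] by simp
        then have "c * (1 / \<tau>) \<le> c * l" using c by (intro mult_left_mono) auto
        then have "c / \<tau> \<le> s" using c by (simp add: s_def)
        then have "c / \<tau> * (\<tau> / K) \<le> s * r"
          using \<open>\<tau> / K \<le> r\<close> c \<tau> K s0 by (intro mult_mono) auto
        then have sr: "c / K \<le> s * r" using \<tau> by simp
        have "norm (osc (D 0) r \<delta>) \<le> 2 * (vdc_const k + 2 + 2 * (K / c)) / (s * r)"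
        proof (rule osc_tail_van_der_Corput[OF r(1,3) ds k(1) s0])
          show "(\<forall>t\<in>{-\<delta>..\<delta>}. s ^ k \<le> D k t) \<or> (\<forall>t\<in>{-\<delta>..\<delta>}. D k t \<le> - (s ^ k))"
            using sgn sk by (meson neg_le_iff_le order_trans)
          show "\<delta> * \<bar>D 2 t\<bar> \<le> K / c * s" if "k = 1" "t \<in> {-\<delta>..\<delta>}" for t
          proof -
            have "\<delta> * \<bar>D 2 t\<bar> \<le> 1 * (K * l)" using bd(2)[OF that(2)] \<delta> by (intro mult_mono) auto
            also have "\<dots> = K / c * s" using that c by (simp add: s_def)
            finally show ?thesis .
          qed
        qed (use K c in auto)
        also have "\<dots> \<le> 2 * (V + 2 + 2 * (K / c)) / (c / K)"
          using sr c K V[OF k(2)] V0 by (intro frac_le) auto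
        finally show ?thesis by (simp add: B_def)
      qed
      moreover have "norm (osc (D 0) e \<delta>) \<le> norm (osc (D 0) e r) + norm (osc (D 0) r \<delta>)"
        by (rule norm_osc_split_le[OF e(1) r(2,3) cont])
      ultimately show ?thesis
        unfolding C_def using K by linarith
    qed
  qed
  then show ?thesis by (intro exI[of _ C]) blast
qed

subsection \<open>Finite-dimensional families of analytic phases\<close>

lemma finite_type_functionals:
  fixes a :: "nat \<Rightarrow> 'e::euclidean_space"
  shows "\<exists>m\<ge>1. \<exists>c>0. \<forall>v. \<exists>w. (\<forall>k\<ge>1. w \<bullet> a k = v \<bullet> a k) \<and>
    (\<exists>k\<in>{1..m}. c * norm w \<le> \<bar>w \<bullet> a k\<bar>)"
proof -
  obtain B where B: "B \<subseteq> a ` {1..}" "independent B" "a ` {1..} \<subseteq> span B"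
    by (rule maximal_independent_subset)
  have "finite B" using B(2) by (rule independent_imp_finite)
  then obtain I where I: "I \<subseteq> {1..}" "finite I" "B = a ` I"
    using B(1) finite_subset_image[of B a "{1..}"] by blast
  define m where "m = Max (insert 1 I)"
  have m: "1 \<le> m" "I \<subseteq> {1..m}" using I by (auto simp: m_def)
  define W where "W = span B"
  have aW: "a k \<in> W" if "1 \<le> k" for k using B(3) that by (auto simp: W_def)
  define f where "f w = (\<Sum>k\<in>{1..m}. \<bar>w \<bullet> a k\<bar>)" for w
  have f0: "0 \<le> f w" for w unfolding f_def by (intro sum_nonneg) auto
  have pos: "0 < f w" if "w \<in> W" "w \<noteq> 0" for w
  proof -
    have "f w \<noteq> 0"
    proof
      assume "f w = 0"
      then have "\<forall>k\<in>{1..m}. w \<bullet> a k = 0" by (auto simp: f_def sum_nonneg_eq_0_iff)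
      then have "orthogonal w b" if "b \<in> B" for b using that m I by (auto simp: orthogonal_def)
      then have "orthogonal w w" using that orthogonal_to_span[of w B w] by (simp add: W_def)
      then show False using that by (simp add: orthogonal_self)
    qed
    then show ?thesis using f0[of w] by simp
  qed
  obtain c where c: "0 < c" "\<And>w. w \<in> W \<Longrightarrow> c * norm w \<le> f w"
  proof -
    let ?S = "sphere 0 1 \<inter> W"
    have scale: "f w = norm w * f (w /\<^sub>R norm w)" for w
      by (cases "w = 0") (auto simp: f_def sum_distrib_left abs_mult field_simps)
    show ?thesis
    proof (cases "?S = {}")
      case True
      have "w = 0" if "w \<in> W" for w
      proof (rule ccontr)
        assume "w \<noteq> 0"
        then have "w /\<^sub>R norm w \<in> ?S" using that by (auto simp: W_def span_mul)
        then show False using True by blast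
      qed
      then show ?thesis using that[of 1] f0 by force
    next
      case False
      have "compact ?S" unfolding W_def
        by (intro compact_Int_closed compact_sphere closed_subspace subspace_span)
      moreover have "continuous_on ?S f" unfolding f_def by (intro continuous_intros)
      ultimately obtain u where u: "u \<in> ?S" "\<And>w. w \<in> ?S \<Longrightarrow> f u \<le> f w"
        using continuous_attains_inf[of ?S f] False by blast
      show ?thesis
      proof (rule that[of "f u"])
        show "0 < f u" using u(1) by (intro pos) auto
        fix w assume w: "w \<in> W"
        show "f u * norm w \<le> f w"
        proof (cases "w = 0")
          case False
          then have "w /\<^sub>R norm w \<in> ?S" using w by (auto simp: W_def span_mul)
          from mult_left_mono[OF u(2)[OF this], of "norm w"] show ?thesis
            by (subst scale) (simp add: mult.commute)
        qed (use f0 in simp)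
      qed
    qed
  qed
  have m0: "0 < real m" using m by simp
  show ?thesis
  proof (intro exI[of _ m] exI[of _ "c / m"] conjI allI)
    fix v
    obtain w z where wz: "w \<in> W" "\<And>u. u \<in> W \<Longrightarrow> orthogonal z u" "v = w + z"
      unfolding W_def by (rule orthogonal_subspace_decomp_exists[of B v]) auto
    show "\<exists>w. (\<forall>k\<ge>1. w \<bullet> a k = v \<bullet> a k) \<and> (\<exists>k\<in>{1..m}. c / m * norm w \<le> \<bar>w \<bullet> a k\<bar>)"
    proof (intro exI[of _ w] conjI allI impI)
      show "w \<bullet> a k = v \<bullet> a k" if "1 \<le> k" for k
        using wz aW[OF that] by (simp add: orthogonal_def inner_add_left)
      show "\<exists>k\<in>{1..m}. c / m * norm w \<le> \<bar>w \<bullet> a k\<bar>"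
      proof (rule ccontr)
        assume "\<not> ?thesis"
        then have "\<bar>w \<bullet> a k\<bar> < c / m * norm w" if "k \<in> {1..m}" for k
          using that by (meson not_le)
        then have "f w < (\<Sum>k\<in>{1..m}. c / m * norm w)"
          unfolding f_def using m(1) by (intro sum_strict_mono) auto
        also have "\<dots> = c * norm w" using m0 by simp
        finally show False using c(2)[OF wz(1)] by simp
      qed
    qed
  qed (use m m0 c in auto)
qed

lemma funpow_diffs:
  fixes c :: "nat \<Rightarrow> real"
  shows "(diffs ^^ j) c n = fact (n + j) / fact n * c (n + j)"
proof (induction j arbitrary: n)
  case (Suc j)
  have "(diffs ^^ Suc j) c n = of_nat (Suc n) * (diffs ^^ j) c (Suc n)"
    by (simp add: diffs_def[of "(diffs ^^ j) c"])
  also have "\<dots> = fact (n + Suc j) / fact n * c (n + Suc j)"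
    unfolding Suc.IH by (simp del: of_nat_Suc)
  finally show ?case .
qed simp

definition ps_deriv :: "(nat \<Rightarrow> 'e::euclidean_space) \<Rightarrow> real \<Rightarrow> 'e \<Rightarrow> nat \<Rightarrow> real \<Rightarrow> real" where
  "ps_deriv a x0 v j t = (\<Sum>n. (diffs ^^ j) (\<lambda>n. v \<bullet> a n) n * (t - x0) ^ n)"

lemma ps_deriv_center: "ps_deriv a x0 v j x0 = fact j * (v \<bullet> a j)"
  unfolding ps_deriv_def using powser_zero[of "(diffs ^^ j) (\<lambda>n. v \<bullet> a n)"]
  by (simp add: funpow_diffs)

lemma ps_deriv_cong:
  assumes "\<forall>k\<ge>1. w \<bullet> a k = v \<bullet> a k" "1 \<le> j"
  shows "ps_deriv a x0 w j t = ps_deriv a x0 v j t"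
  using assms by (simp add: ps_deriv_def funpow_diffs)

lemma
  fixes \<psi> :: "real \<Rightarrow> 'e::euclidean_space"
  assumes sums: "\<And>t. t \<in> ball x0 r \<Longrightarrow> (\<lambda>k. (t - x0) ^ k *\<^sub>R a k) sums \<psi> t"
  shows ps_deriv_0: "\<And>v t. t \<in> ball x0 r \<Longrightarrow> ps_deriv a x0 v 0 t = v \<bullet> \<psi> t"
    and deriv_seq_ps_deriv: "\<And>v. deriv_seq (ps_deriv a x0 v) (ball x0 r)"
    and ps_deriv_linear: "\<And>v j t. t \<in> ball x0 r \<Longrightarrow>
      ps_deriv a x0 v j t = (\<Sum>b\<in>Basis. (v \<bullet> b) * ps_deriv a x0 b j t)"
proof -
  define d where "d v j n = (diffs ^^ j) (\<lambda>n. v \<bullet> a n) n" for v j n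
  define D where "D = ps_deriv a x0"
  note D_eq = D_def
  have D_def: "D v j t = (\<Sum>n. d v j n * (t - x0) ^ n)" for v j t
    by (simp add: D_def ps_deriv_def d_def)
  have d: "d v j n = fact (n + j) / fact n * (v \<bullet> a (n + j))" for v j n
    unfolding d_def by (rule funpow_diffs)
  have diffs_d: "diffs (d v j) = d v (Suc j)" for v j
    by (simp add: d_def[abs_def])
  have sums0: "(\<lambda>n. d v 0 n * (t - x0) ^ n) sums (v \<bullet> \<psi> t)" if "t \<in> ball x0 r" for v t
    using bounded_linear.sums[OF bounded_linear_inner_right sums[OF that], of v] by (simp add: d mult.commute)
  have summ: "summable (\<lambda>n. d v j n * h ^ n)" if "norm h < r" for v j h
    using that
  proof (induction j arbitrary: h)
    case 0
    then show ?case using sums0[of "x0 + h" v] by (auto simp: sums_iff dist_norm)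
  next
    case (Suc j)
    have "summable (\<lambda>n. diffs (d v j) n * h ^ n)"
      by (rule termdiff_converges[OF Suc.prems Suc.IH])
    then show ?case by (simp add: diffs_d)
  qed
  have D0: "D v 0 t = v \<bullet> \<psi> t" if "t \<in> ball x0 r" for v t
    using sums0[OF that] by (simp add: D_def sums_iff)
  have ds: "deriv_seq (D v) (ball x0 r)" for v
    unfolding deriv_seq_def
  proof (intro allI ballI)
    fix j t assume "t \<in> ball x0 r"
    then have "norm (t - x0) < r" by (simp add: dist_norm norm_minus_commute)
    from termdiffs_strong'[OF summ this]
    have "((\<lambda>z. \<Sum>n. d v j n * z ^ n) has_real_derivative D v (Suc j) t) (at (t - x0))"
      unfolding D_def diffs_d .
    then show "(D v j has_real_derivative D v (Suc j) t) (at t)"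
      unfolding D_def[abs_def] using DERIV_shift[of "\<lambda>z. \<Sum>n. d v j n * z ^ n" _ t "-x0"] by simp
  qed
  have Dlin: "D v j t = (\<Sum>b\<in>Basis. (v \<bullet> b) * D b j t)" if "t \<in> ball x0 r" for v j t
  proof -
    have h: "norm (t - x0) < r" using that by (simp add: dist_norm norm_minus_commute)
    have "d v j n * (t - x0) ^ n = (\<Sum>b\<in>Basis. (v \<bullet> b) * (d b j n * (t - x0) ^ n))" for n
      unfolding d by (subst euclidean_inner[of v]) (simp add: sum_distrib_left sum_distrib_right mult_ac inner_commute)
    then have "D v j t = (\<Sum>n. \<Sum>b\<in>Basis. (v \<bullet> b) * (d b j n * (t - x0) ^ n))" by (simp add: D_def)
    also have "\<dots> = (\<Sum>b\<in>Basis. \<Sum>n. (v \<bullet> b) * (d b j n * (t - x0) ^ n))"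
      by (intro suminf_sum summable_mult summ h)
    also have "\<dots> = (\<Sum>b\<in>Basis. (v \<bullet> b) * D b j t)"
      unfolding D_def by (intro sum.cong refl suminf_mult summ h)
    finally show ?thesis .
  qed
  show "\<And>v t. t \<in> ball x0 r \<Longrightarrow> ps_deriv a x0 v 0 t = v \<bullet> \<psi> t"
    and "\<And>v. deriv_seq (ps_deriv a x0 v) (ball x0 r)"
    and "\<And>v j t. t \<in> ball x0 r \<Longrightarrow>
      ps_deriv a x0 v j t = (\<Sum>b\<in>Basis. (v \<bullet> b) * ps_deriv a x0 b j t)"
    using D0 ds Dlin by (simp_all add: D_eq)
qed

lemma analytic_osc_bounded:
  fixes \<psi> :: "real \<Rightarrow> 'e::euclidean_space"
  assumes r: "0 < r" and sums: "\<And>t. t \<in> ball x0 r \<Longrightarrow> (\<lambda>k. (t - x0) ^ k *\<^sub>R a k) sums \<psi> t"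
  shows "\<exists>\<delta>>0. \<delta> \<le> 1/4 \<and> 2 * \<delta> \<le> r \<and> (\<exists>C. \<forall>x\<in>ball x0 \<delta>. \<forall>v e. 0 < e \<longrightarrow> e \<le> \<delta> \<longrightarrow>
    norm (osc (\<lambda>t. v \<bullet> \<psi> (x + t)) e \<delta>) \<le> C)"
proof -
  define D where "D = ps_deriv a x0"
  have D0: "D v 0 t = v \<bullet> \<psi> t" if "t \<in> ball x0 r" for v t
    unfolding D_def by (rule ps_deriv_0[OF _ that]) (rule sums)
  have ds: "deriv_seq (D v) (ball x0 r)" for v
    unfolding D_def by (rule deriv_seq_ps_deriv) (rule sums)
  have Dlin: "D v j t = (\<Sum>b\<in>Basis. (v \<bullet> b) * D b j t)" if "t \<in> ball x0 r" for v j t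
    unfolding D_def by (rule ps_deriv_linear[OF _ that]) (rule sums)
  note Dx0 = ps_deriv_center[of a x0, folded D_def] and Dcong = ps_deriv_cong[of _ a _ _ x0, folded D_def]
  define \<rho> where "\<rho> = r / 2"
  have \<rho>: "0 < \<rho>" "cball x0 \<rho> \<subseteq> ball x0 r" using r by (auto simp: \<rho>_def)
  have "\<exists>M. \<forall>t\<in>cball x0 \<rho>. \<bar>D b j t\<bar> \<le> M" for b j
  proof -
    have "continuous_on (cball x0 \<rho>) (D b j)"
      using deriv_seq_cont[OF ds] \<rho>(2) continuous_on_subset by blast
    then have "bounded (D b j ` cball x0 \<rho>)" by (intro compact_imp_bounded compact_continuous_image) auto
    then show ?thesis by (auto simp: bounded_iff)
  qed
  then obtain M where M: "\<And>b j t. t \<in> cball x0 \<rho> \<Longrightarrow> \<bar>D b j t\<bar> \<le> M b j" by metis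
  have M0: "0 \<le> M b j" for b j using M[of x0 b j] \<rho>(1) by auto
  define N where "N j = (\<Sum>b\<in>Basis. M b j)" for j
  have N0: "0 \<le> N j" for j unfolding N_def by (intro sum_nonneg M0)
  have DN: "\<bar>D v j t\<bar> \<le> N j * norm v" if "t \<in> cball x0 \<rho>" for v j t
  proof -
    have "\<bar>D v j t\<bar> \<le> (\<Sum>b\<in>Basis. \<bar>(v \<bullet> b) * D b j t\<bar>)"
      using Dlin[where t=t and v=v and j=j] that \<rho>(2) by (auto intro: sum_abs)
    also have "\<dots> \<le> (\<Sum>b\<in>Basis. norm v * M b j)"
      unfolding abs_mult by (intro sum_mono mult_mono Basis_le_norm M that) auto
    finally show ?thesis by (simp add: N_def sum_distrib_left mult.commute)
  qed
  obtain m c where m: "1 \<le> m" and c: "0 < c"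
    and ft: "\<And>v. \<exists>w. (\<forall>k\<ge>1. w \<bullet> a k = v \<bullet> a k) \<and> (\<exists>k\<in>{1..m}. c * norm w \<le> \<bar>w \<bullet> a k\<bar>)"
    using finite_type_functionals[of a] by blast
  define K where "K = 1 + (\<Sum>j\<le>m + 2. N j)"
  have K1: "1 \<le> K" unfolding K_def using sum_nonneg[of "{..m+2}" N] N0 by simp
  have NK: "N j \<le> K" if "j \<le> m + 2" for j
    unfolding K_def using member_le_sum[of j "{..m+2}" N] that N0 by simp
  have DK: "\<bar>D v j t\<bar> \<le> K * norm v" if "t \<in> cball x0 \<rho>" "j \<le> m + 2" for v j t
    using DN[OF that(1), of v j] mult_right_mono[OF NK[OF that(2)], of "norm v"] by simp
  define \<delta> where "\<delta> = min (1/4) (min (\<rho> / 2) (c / (4 * K)))"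
  have \<delta>: "0 < \<delta>" "\<delta> \<le> 1/4" "2 * \<delta> \<le> \<rho>" using \<rho> c K1 by (auto simp: \<delta>_def)
  have "\<delta> \<le> c / (4 * K)" by (simp add: \<delta>_def)
  then have \<delta>K: "2 * \<delta> * K \<le> c / 2" using K1 by (simp add: field_simps)
  define c' where "c' = min 1 (c / 2)"
  have c': "0 < c'" "c' \<le> 1" "c' \<le> c / 2" using c by (auto simp: c'_def)
  have "\<delta> \<le> 1" using \<delta> by simp
  from osc_finite_type_bounded[OF m K1 c'(1,2) \<delta>(1) this]
  obtain C where C: "\<And>D l k e. deriv_seq D {-\<delta>..\<delta>} \<Longrightarrow> 0 \<le> l \<Longrightarrow> 1 \<le> k \<Longrightarrow> k \<le> m \<Longrightarrow>
    (\<forall>t\<in>{-\<delta>..\<delta>}. \<bar>D 1 t\<bar> \<le> K * l \<and> \<bar>D 2 t\<bar> \<le> K * l \<and> \<bar>D (Suc m) t\<bar> \<le> K * l) \<Longrightarrow>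
    (\<forall>t\<in>{-\<delta>..\<delta>}. c' * l \<le> D k t) \<or> (\<forall>t\<in>{-\<delta>..\<delta>}. D k t \<le> - (c' * l)) \<Longrightarrow>
    0 < e \<Longrightarrow> e \<le> \<delta> \<Longrightarrow> norm (osc (D 0) e \<delta>) \<le> C" by metis
  have "norm (osc (\<lambda>t. v \<bullet> \<psi> (x + t)) e \<delta>) \<le> C"
    if x: "x \<in> ball x0 \<delta>" and e: "0 < e" "e \<le> \<delta>" for x v e
  proof -
    obtain w k where w: "\<forall>k\<ge>1. w \<bullet> a k = v \<bullet> a k" and k: "1 \<le> k" "k \<le> m" "c * norm w \<le> \<bar>w \<bullet> a k\<bar>"
      using ft[of v] by auto
    have near: "\<bar>x + t - x0\<bar> \<le> 2 * \<delta>" if "t \<in> {-\<delta>..\<delta>}" for t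
      using x that unfolding mem_ball dist_real_def atLeastAtMost_iff by linarith
    have cb: "x + t \<in> cball x0 \<rho>" if "t \<in> {-\<delta>..\<delta>}" for t
      using near[OF that] \<delta>(3) by (simp add: dist_real_def abs_minus_commute)
    have inb: "x + t \<in> ball x0 r" if "t \<in> {-\<delta>..\<delta>}" for t using cb[OF that] \<rho>(2) by blast
    define E where "E j t = D v j (x + t)" for j t
    have E: "deriv_seq E {-\<delta>..\<delta>}"
      unfolding E_def using ds inb by (rule deriv_seq_shift)
    have Ew: "E j t = D w j (x + t)" if "1 \<le> j" for j t
      unfolding E_def using Dcong[OF w that] by simp
    have bd: "\<bar>E j t\<bar> \<le> K * norm w" if "1 \<le> j" "j \<le> m + 2" "t \<in> {-\<delta>..\<delta>}" for j t
      using DK[OF cb[OF that(3)] that(2)] Ew[OF that(1)] by simp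
    have var: "\<bar>D w k (x + t) - D w k x0\<bar> \<le> c / 2 * norm w" if "t \<in> {-\<delta>..\<delta>}" for t
    proof -
      have "norm (D w k (x + t) - D w k x0) \<le> (K * norm w) * norm (x + t - x0)"
      proof (rule field_differentiable_bound)
        fix z assume z: "z \<in> cball x0 \<rho>"
        show "(D w k has_real_derivative D w (Suc k) z) (at z within cball x0 \<rho>)"
          using deriv_seqD[OF ds] z \<rho>(2) by (blast intro: has_field_derivative_at_within)
        show "norm (D w (Suc k) z) \<le> K * norm w" using DK[OF z, of "Suc k" w] k by simp
      qed (use cb[OF that] \<rho> in auto)
      also have "\<dots> \<le> (K * norm w) * (2 * \<delta>)"
        using near[OF that] K1 by (intro mult_left_mono) auto
      also have "\<dots> = (2 * \<delta> * K) * norm w" by simp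
      also have "\<dots> \<le> c / 2 * norm w" by (intro mult_right_mono \<delta>K) auto
      finally show ?thesis by simp
    qed
    have "1 * \<bar>w \<bullet> a k\<bar> \<le> fact k * \<bar>w \<bullet> a k\<bar>" by (intro mult_right_mono fact_ge_1) auto
    then have lo: "c * norm w \<le> \<bar>D w k x0\<bar>" using k(3) by (simp add: Dx0 abs_mult)
    have c'w: "c' * norm w \<le> c / 2 * norm w" using c'(3) by (rule mult_right_mono) simp
    have half: "c * norm w = c / 2 * norm w + c / 2 * norm w" by simp
    have "norm (osc (E 0) e \<delta>) \<le> C"
    proof (rule C[OF E, of "norm w" k])
      show "\<forall>t\<in>{-\<delta>..\<delta>}. \<bar>E 1 t\<bar> \<le> K * norm w \<and> \<bar>E 2 t\<bar> \<le> K * norm w \<and> \<bar>E (Suc m) t\<bar> \<le> K * norm w"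
        using m by (auto intro!: bd)
      show "(\<forall>t\<in>{-\<delta>..\<delta>}. c' * norm w \<le> E k t) \<or> (\<forall>t\<in>{-\<delta>..\<delta>}. E k t \<le> - (c' * norm w))"
      proof (cases "0 \<le> D w k x0")
        case True
        have "c' * norm w \<le> E k t" if "t \<in> {-\<delta>..\<delta>}" for t
          using var[OF that] lo True c'w half unfolding Ew[OF k(1)] by linarith
        then show ?thesis by blast
      next
        case False
        have "E k t \<le> - (c' * norm w)" if "t \<in> {-\<delta>..\<delta>}" for t
          using var[OF that] lo False c'w half unfolding Ew[OF k(1)] by linarith
        then show ?thesis by blast
      qed
    qed (use k e in auto)
    moreover have "osc (E 0) e \<delta> = osc (\<lambda>t. v \<bullet> \<psi> (x + t)) e \<delta>"
    proof -
      have E0: "E 0 t = v \<bullet> \<psi> (x + t)" if "t \<in> {-\<delta>..\<delta>}" for t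
        unfolding E_def by (rule D0[OF inb[OF that]])
      show ?thesis unfolding osc_def
        by (rule integral_cong) (use e in \<open>simp add: E0\<close>)
    qed
    ultimately show ?thesis by simp
  qed
  moreover have "2 * \<delta> \<le> r" using \<delta>(3) r by (simp add: \<rho>_def)
  ultimately show ?thesis using \<delta> by blast
qed

subsection \<open>Dirichlet kernel\<close>

lemma circle_exp_cis: "circle_exp t = cis (2 * pi * t)"
  by (simp add: circle_exp_def cis_conv_exp mult_ac)

lemma circle_exp_periodic: "circle_exp (t + of_int k) = circle_exp t"
  by (simp add: circle_exp_cis distrib_left cis_mult[symmetric] cis_multiple_2pi)

lemma circle_exp_in_circle: "circle_exp t \<in> circle"
  by (simp add: circle_exp_cis circle_def)

lemma circle_eq_image: "circle = circle_exp ` {0..1}"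
proof
  show "circle \<subseteq> circle_exp ` {0..1}"
  proof
    fix z assume "z \<in> circle"
    then have "norm z = 1" by (simp add: circle_def)
    then have "z = cis (Arg2pi z)"
      using Arg2pi_eq[of z] by (simp add: cis_conv_exp)
    then have "z = circle_exp (Arg2pi z / (2 * pi))" by (simp add: circle_exp_cis)
    moreover have "Arg2pi z / (2 * pi) \<in> {0..1}"
      using Arg2pi_ge_0[of z] Arg2pi_lt_2pi[of z] by (auto simp: field_simps)
    ultimately show "z \<in> circle_exp ` {0..1}" by blast
  qed
qed (auto simp: circle_exp_in_circle)

definition dirichlet :: "nat \<Rightarrow> real \<Rightarrow> complex" where
  "dirichlet N t = (\<Sum>n = - int N..int N. cis (2 * pi * of_int n * t))"

lemma dirichlet_uminus: "dirichlet N (- t) = dirichlet N t"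
  unfolding dirichlet_def
  by (rule sum.reindex_bij_witness[of _ uminus uminus]) auto

lemma dirichlet_periodic: "dirichlet N (t + of_int k) = dirichlet N t"
proof -
  have "cis (2 * pi * of_int n * (t + of_int k)) = cis (2 * pi * of_int n * t)" for n
  proof -
    have "cis (2 * pi * of_int n * (t + of_int k)) = cis (2 * pi * of_int n * t) * cis (2 * pi * of_int (n * k))"
      by (simp add: cis_mult algebra_simps)
    then show ?thesis by (simp only: cis_multiple_2pi[OF Ints_of_int] mult_1_right)
  qed
  then show ?thesis by (simp add: dirichlet_def)
qed

lemma continuous_on_dirichlet [continuous_intros]:
  "continuous_on S f \<Longrightarrow> continuous_on S (\<lambda>t. dirichlet N (f t))"
  unfolding dirichlet_def by (intro continuous_intros)

lemma norm_dirichlet_le: "norm (dirichlet N t) \<le> 2 * real N + 1"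
proof -
  have "norm (dirichlet N t) \<le> (\<Sum>n = - int N..int N. norm (cis (2 * pi * of_int n * t)))"
    unfolding dirichlet_def by (rule norm_sum)
  then show ?thesis by simp
qed

lemma dirichlet_sin: "dirichlet N t * of_real (sin (pi * t)) = of_real (sin ((2 * real N + 1) * pi * t))"
proof (induction N)
  case (Suc N)
  have "{- int (Suc N)..int (Suc N)} = insert (- int (Suc N)) (insert (int (Suc N)) {- int N..int N})"
    by auto
  then have "dirichlet (Suc N) t = cis (2 * pi * of_int (- int (Suc N)) * t)
      + (cis (2 * pi * of_int (int (Suc N)) * t) + dirichlet N t)"
    unfolding dirichlet_def by (simp del: of_int_minus of_int_of_nat_eq of_nat_Suc)
  also have "\<dots> = of_real (2 * cos (2 * (real N + 1) * pi * t)) + dirichlet N t"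
  proof -
    have "2 * pi * of_int (- int (Suc N)) * t = - (2 * (real N + 1) * pi * t)"
      "2 * pi * of_int (int (Suc N)) * t = 2 * (real N + 1) * pi * t"
      by (simp_all add: algebra_simps)
    then show ?thesis by (simp only:) (simp add: complex_eq_iff)
  qed
  finally have "dirichlet (Suc N) t * of_real (sin (pi * t))
     = of_real (2 * cos (2 * (real N + 1) * pi * t) * sin (pi * t) + sin ((2 * real N + 1) * pi * t))"
    using Suc by (simp add: distrib_right)
  also have "2 * cos (2 * (real N + 1) * pi * t) * sin (pi * t) + sin ((2 * real N + 1) * pi * t)
      = sin ((2 * real (Suc N) + 1) * pi * t)"
  proof -
    have e: "(2 * real (Suc N) + 1) * pi * t = 2 * (real N + 1) * pi * t + pi * t"
        "(2 * real N + 1) * pi * t = 2 * (real N + 1) * pi * t - pi * t"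
      by (simp_all add: algebra_simps)
    show ?thesis unfolding e sin_add sin_diff by simp
  qed
  finally show ?case .
qed (simp add: dirichlet_def)

lemma abs_sin_diff_le: "\<bar>sin x - x\<bar> \<le> x\<^sup>2 / 2" for x :: real
  using Maclaurin_sin_bound[of x 2] by (simp add: numeral_2_eq_2 sin_coeff_def)

lemma sin_pi_ge:
  assumes "0 \<le> t" "t \<le> 1/2"
  shows "t / 2 \<le> sin (pi * t)"
proof -
  have "pi * t - (pi * t)\<^sup>2 / 2 \<le> sin (pi * t)"
    using abs_sin_diff_le[of "pi * t"] by linarith
  moreover have "pi * t - (pi * t)\<^sup>2 / 2 = (pi * t) * (1 - pi * t / 2)"
    by (simp add: power2_eq_square algebra_simps)
  moreover have "3 * t * (1 - 3.2 * (1/2) / 2) \<le> (pi * t) * (1 - pi * t / 2)"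
  proof (intro mult_mono)
    show "1 - 3.2 * (1/2) / 2 \<le> 1 - pi * t / 2"
      using mult_mono[of pi "3.2" t "1/2"] assms pi_approx by simp
  qed (use assms pi_gt3 in auto)
  ultimately show ?thesis using assms by simp
qed

lemma sin_pi_pos:
  assumes "0 < t" "t \<le> 1/2"
  shows "0 < sin (pi * t)"
  using sin_pi_ge[of t] assms by simp

lemma dirichlet_eq:
  assumes "0 < t" "t \<le> 1/2"
  shows "dirichlet N t = of_real (sin ((2 * real N + 1) * pi * t) / sin (pi * t))"
  using dirichlet_sin[of N t] sin_pi_pos[OF assms] by (simp add: field_simps)

lemma norm_dirichlet_le_inverse:
  assumes "0 < t" "t \<le> 1/2"
  shows "norm (dirichlet N t) \<le> 2 / t"
proof -
  have "norm (dirichlet N t) = \<bar>sin ((2 * real N + 1) * pi * t)\<bar> / sin (pi * t)"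
    unfolding dirichlet_eq[OF assms] norm_of_real using sin_pi_pos[OF assms] by simp
  also have "\<dots> \<le> 1 / (t / 2)"
    using sin_pi_ge[of t] assms by (intro frac_le) auto
  finally show ?thesis by simp
qed

lemma integral_cis_period:
  "n \<noteq> 0 \<Longrightarrow> integral {0..1} (\<lambda>t. cis (2 * pi * of_int n * t)) = 0"
proof -
  assume n: "n \<noteq> 0"
  define c where "c = \<i> * of_real (2 * pi * of_int n)"
  have c: "c \<noteq> 0" using n by (simp add: c_def)
  have "((\<lambda>t. cis (2 * pi * of_int n * t)) has_integral
      (inverse c * cis (2 * pi * of_int n * 1) - inverse c * cis (2 * pi * of_int n * 0))) {0..1}"
  proof (rule fundamental_theorem_of_calculus)
    fix t :: real
    have "((\<lambda>t. cis (2 * pi * of_int n * t)) has_vector_derivative c * cis (2 * pi * of_int n * t)) (at t)"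
      unfolding c_def by (intro has_vector_derivative_cis) (auto intro!: derivative_eq_intros)
    from has_vector_derivative_mult_right[OF this, of "inverse c"]
    have "((\<lambda>t. inverse c * cis (2 * pi * of_int n * t)) has_vector_derivative
        inverse c * (c * cis (2 * pi * of_int n * t))) (at t)" .
    also have "inverse c * (c * cis (2 * pi * of_int n * t)) = cis (2 * pi * of_int n * t)"
      using c by simp
    finally show "((\<lambda>t. inverse c * cis (2 * pi * of_int n * t)) has_vector_derivative
        cis (2 * pi * of_int n * t)) (at t within {0..1})"
      by (rule has_vector_derivative_at_within)
  qed simp
  moreover have "cis (2 * pi * of_int n * 1) = 1"
    by (simp add: cis_multiple_2pi)
  ultimately show ?thesis by (simp add: integral_unique)
qed

lemma integral_periodic:
  fixes H :: "real \<Rightarrow> complex"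
  assumes c: "continuous_on UNIV H" and per: "\<And>t k. H (t + of_int k) = H t"
  shows "integral {a..a + 1} H = integral {0..1} H"
proof -
  have int: "H integrable_on {u..v}" for u v
    by (intro integrable_continuous_real continuous_on_subset[OF c]) auto
  have shift: "integral {u + of_int k..v + of_int k} H = integral {u..v} H" for u v k
    using integral_shift_Icc_real[of u v H "of_int k"] by (simp add: o_def per add.commute)
  define k where "k = \<lfloor>a\<rfloor>"
  have k: "of_int k \<le> a" "a \<le> of_int k + 1" unfolding k_def by linarith+
  have "integral {a..a + 1} H = integral {a..of_int k + 1} H + integral {of_int k + 1..a + 1} H"
    using k by (intro Henstock_Kurzweil_Integration.integral_combine[symmetric] int) auto
  also have "integral {of_int k + 1..a + 1} H = integral {of_int k..a} H"
    using shift[of "of_int k" 1 a] by simp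
  also have "integral {a..of_int k + 1} H + integral {of_int k..a} H = integral {of_int k..of_int k + 1} H"
    using k Henstock_Kurzweil_Integration.integral_combine[of "of_int k" a "of_int k + 1" H] int
    by (simp add: add.commute)
  also have "\<dots> = integral {0..1} H" using shift[of 0 k 1] by (simp add: add.commute)
  finally show ?thesis .
qed

lemma fourier_coeff_integral:
  assumes "continuous_on UNIV (\<lambda>t. g (circle_exp t))"
  shows "fourier_coeff g n = integral {0..1} (\<lambda>t. g (circle_exp t) * cis (- (2 * pi * of_int n * t)))"
proof -
  have e: "exp (- (2 * pi * \<i> * (of_int n * complex_of_real t))) = cis (- (2 * pi * of_int n * t))" for t
    by (simp add: cis_conv_exp mult_ac)
  have "continuous_on {0..1} (\<lambda>t. g (circle_exp t) * cis (- (2 * pi * of_int n * t)))"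
    by (intro continuous_intros continuous_on_subset[OF assms]) auto
  then show ?thesis
    unfolding fourier_coeff_def e by (intro set_borel_integral_eq_integral borel_integrable_atLeastAtMost')
qed

lemma fourier_partial_sum_dirichlet:
  assumes c: "continuous_on UNIV (\<lambda>t. g (circle_exp t))"
  shows "fourier_partial_sum g N (circle_exp x)
    = integral {0..1/2} (\<lambda>t. (g (circle_exp (x + t)) + g (circle_exp (x - t))) * dirichlet N t)"
proof -
  define G where "G t = g (circle_exp t)" for t
  have c: "continuous_on S G" for S
    unfolding G_def by (rule continuous_on_subset[OF c]) auto
  have cG: "continuous_on S (\<lambda>t. G (f t))" if "continuous_on S f" for S f
    by (rule continuous_on_compose2[OF c that]) auto
  have "fourier_partial_sum g N (circle_exp x)
      = (\<Sum>n = - int N..int N. integral {0..1} (\<lambda>t. G t * cis (- (2 * pi * of_int n * t)) * cis (2 * pi * of_int n * x)))"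
  proof -
    have e: "of_int n * (2 * pi * x) = 2 * pi * of_int n * x" for n by simp
    show ?thesis
      unfolding fourier_partial_sum_def fourier_coeff_integral[OF assms] circle_exp_cis[of x] cis_power_int
        e G_def integral_mult_left ..
  qed
  also have "\<dots> = integral {0..1} (\<lambda>t. \<Sum>n = - int N..int N. G t * cis (- (2 * pi * of_int n * t)) * cis (2 * pi * of_int n * x))"
    by (intro integral_sum[symmetric] integrable_continuous_real continuous_intros c) auto
  also have "\<dots> = integral {0..1} (\<lambda>t. G t * dirichlet N (x - t))"
    by (simp add: dirichlet_def sum_distrib_left cis_mult mult.assoc algebra_simps)
  also have "\<dots> = integral {x - 1/2..x - 1/2 + 1} (\<lambda>t. G t * dirichlet N (x - t))"
  proof (rule integral_periodic[symmetric])
    fix t k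
    have "dirichlet N (x - (t + of_int k)) = dirichlet N (x - t + of_int (- k))" by (simp add: algebra_simps)
    also have "\<dots> = dirichlet N (x - t)" by (rule dirichlet_periodic)
    finally show "G (t + of_int k) * dirichlet N (x - (t + of_int k)) = G t * dirichlet N (x - t)"
      by (simp add: G_def circle_exp_periodic)
  qed (intro continuous_intros c)
  also have "\<dots> = integral {- (1/2)..1/2} (\<lambda>t. G (x + t) * dirichlet N t)"
    using integral_shift_Icc_real[of "-(1/2)" "1/2" "\<lambda>t. G t * dirichlet N (x - t)" x]
    by (simp add: o_def dirichlet_uminus add.commute)
  also have "\<dots> = integral {- (1/2)..0} (\<lambda>t. G (x + t) * dirichlet N t) + integral {0..1/2} (\<lambda>t. G (x + t) * dirichlet N t)"
    by (intro Henstock_Kurzweil_Integration.integral_combine[symmetric] integrable_continuous_real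
        continuous_intros cG) auto
  also have "integral {- (1/2)..0} (\<lambda>t. G (x + t) * dirichlet N t) = integral {0..1/2} (\<lambda>t. G (x - t) * dirichlet N t)"
    using Henstock_Kurzweil_Integration.integral_reflect_real[of "1/2" 0 "\<lambda>t. G (x - t) * dirichlet N t"]
    by (simp add: dirichlet_uminus)
  also have "\<dots> + integral {0..1/2} (\<lambda>t. G (x + t) * dirichlet N t)
      = integral {0..1/2} (\<lambda>t. G (x - t) * dirichlet N t + G (x + t) * dirichlet N t)"
    by (intro integral_add[symmetric] integrable_continuous_real continuous_intros cG)
  finally show ?thesis by (simp add: G_def algebra_simps)
qed

lemma integral_dirichlet: "integral {0..1/2} (dirichlet N) = 1 / 2"
proof -
  have c: "fourier_coeff (\<lambda>_. 1) n = (if n = 0 then 1 else 0)" for n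
    using integral_cis_period[of "- n"] by (simp add: fourier_coeff_integral)
  have "fourier_partial_sum (\<lambda>_. 1) N (circle_exp 0) = (\<Sum>n = - int N..int N. if n = 0 then 1 else 0)"
    unfolding fourier_partial_sum_def c by (rule sum.cong) auto
  also have "\<dots> = 1" by simp
  finally have "integral {0..1/2} (\<lambda>t. 2 * dirichlet N t) = 1"
    by (simp add: fourier_partial_sum_dirichlet)
  then show ?thesis by (simp add: mult.commute)
qed

lemma fourier_partial_sum_locally_bounded:
  fixes g :: "complex \<Rightarrow> complex"
  defines "G t \<equiv> g (circle_exp t)"
  assumes c: "continuous_on UNIV G" and G1: "\<And>t. norm (G t) \<le> 1"
    and \<delta>: "0 < \<delta>" "\<delta> \<le> 1/4"
    and C: "\<And>l e. 0 < e \<Longrightarrow> e \<le> \<delta> \<Longrightarrow>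
      norm (integral {e..\<delta>} (\<lambda>t. (G (x + t) * cis (l * t) - G (x - t) * cis (- (l * t))) / of_real t)) \<le> C"
  shows "norm (fourier_partial_sum g N (circle_exp x)) \<le> 1 + 2 / \<delta> + C + pi"
proof -
  have cG: "continuous_on S (\<lambda>t. G (f t))" if "continuous_on S f" for S and f :: "real \<Rightarrow> real"
    by (rule continuous_on_compose2[OF c that]) auto
  define F where "F t = G (x + t) + G (x - t)" for t
  have cF: "continuous_on S F" for S unfolding F_def by (intro continuous_intros cG)
  have F2: "norm (F t) \<le> 2" for t
    unfolding F_def using norm_triangle_ineq[of "G (x + t)" "G (x - t)"] G1[of "x + t"] G1[of "x - t"] by linarith
  let ?I = "\<lambda>a b. integral {a..b} (\<lambda>t. F t * dirichlet N t)"
  have int: "(\<lambda>t. F t * dirichlet N t) integrable_on {a..b}" for a b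
    by (intro integrable_continuous_real continuous_intros cF)
  define e where "e = \<delta> / (2 * real N + 1)"
  have e: "0 < e" "e \<le> \<delta>" "(2 * real N + 1) * e = \<delta>" using \<delta> by (auto simp: e_def field_simps)
  have I1: "norm (?I 0 e) \<le> 1"
  proof -
    have "norm (?I 0 e) \<le> integral {0..e} (\<lambda>t. 2 * (2 * real N + 1))"
    proof (rule integral_norm_bound_integral[OF int])
      show "norm (F t * dirichlet N t) \<le> 2 * (2 * real N + 1)" for t
        unfolding norm_mult by (intro mult_mono F2 norm_dirichlet_le) auto
    qed (rule integrable_const_ivl)
    also have "\<dots> = 2 * ((2 * real N + 1) * e)" using e(1) by simp
    also have "\<dots> = 2 * \<delta>" unfolding e(3) ..
    finally show ?thesis using \<delta> by simp
  qed
  have I3: "norm (?I \<delta> (1/2)) \<le> 2 / \<delta>"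
  proof -
    have "norm (?I \<delta> (1/2)) \<le> integral {\<delta>..1/2} (\<lambda>t. 2 * (2 / \<delta>))"
    proof (rule integral_norm_bound_integral[OF int])
      fix t assume t: "t \<in> {\<delta>..1/2}"
      have "norm (dirichlet N t) \<le> 2 / t" using t \<delta> by (intro norm_dirichlet_le_inverse) auto
      also have "\<dots> \<le> 2 / \<delta>" using t \<delta> by (intro divide_left_mono) auto
      finally show "norm (F t * dirichlet N t) \<le> 2 * (2 / \<delta>)"
        unfolding norm_mult by (intro mult_mono F2) auto
    qed (rule integrable_const_ivl)
    also have "\<dots> = (1/2 - \<delta>) * (4 / \<delta>)" using \<delta> by simp
    also have "\<dots> \<le> 1/2 * (4 / \<delta>)" using \<delta> by (intro mult_right_mono) auto
    finally show ?thesis by simp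
  qed
  have I2: "norm (?I e \<delta>) \<le> C + pi"
  proof -
    define M where "M = (2 * real N + 1) * pi"
    define J where "J l = integral {e..\<delta>} (\<lambda>t. (G (x + t) * cis (l * t) - G (x - t) * cis (- (l * t))) / of_real t)" for l
    define k where "k t = F t * of_real (sin (M * t) * (1 / sin (pi * t) - 1 / (pi * t)))" for t
    have ne: "t \<noteq> 0" "sin (pi * t) \<noteq> 0" if "t \<in> {e..\<delta>}" for t
      using sin_pi_pos[of t] that e \<delta> by auto
    have intJ: "(\<lambda>t. (G (x + t) * cis (l * t) - G (x - t) * cis (- (l * t))) / of_real t) integrable_on {e..\<delta>}" for l
      by (intro integrable_continuous_real continuous_intros cG) (use ne in auto)
    have intk: "k integrable_on {e..\<delta>}"
      unfolding k_def by (intro integrable_continuous_real continuous_intros cF) (use ne in auto)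
    have eq: "F t * dirichlet N t = 1 / (2 * pi * \<i>) * ((G (x + t) * cis (M * t) - G (x - t) * cis (- (M * t))) / of_real t
        - (G (x + t) * cis (- M * t) - G (x - t) * cis (- (- M * t))) / of_real t) + k t" if t: "t \<in> {e..\<delta>}" for t
    proof -
      have "(G (x + t) * cis (M * t) - G (x - t) * cis (- (M * t)))
          - (G (x + t) * cis (- M * t) - G (x - t) * cis (- (- M * t))) = F t * (cis (M * t) - cis (- (M * t)))"
        by (simp add: F_def algebra_simps)
      also have "cis (M * t) - cis (- (M * t)) = 2 * \<i> * of_real (sin (M * t))"
        by (simp add: complex_eq_iff)
      finally have 1: "(G (x + t) * cis (M * t) - G (x - t) * cis (- (M * t))) / of_real t
          - (G (x + t) * cis (- M * t) - G (x - t) * cis (- (- M * t))) / of_real t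
          = F t * (2 * \<i> * of_real (sin (M * t))) / of_real t"
        by (simp only: diff_divide_distrib[symmetric])
      have "dirichlet N t = of_real (sin (M * t) / sin (pi * t))"
        using t e \<delta> by (subst dirichlet_eq) (auto simp: M_def mult_ac)
      also have "sin (M * t) / sin (pi * t) = sin (M * t) / (pi * t) + sin (M * t) * (1 / sin (pi * t) - 1 / (pi * t))"
        by (simp add: algebra_simps)
      finally show ?thesis unfolding 1 using ne[OF t] by (simp add: k_def field_simps)
    qed
    have "?I e \<delta> = integral {e..\<delta>} (\<lambda>t. 1 / (2 * pi * \<i>) * ((G (x + t) * cis (M * t) - G (x - t) * cis (- (M * t))) / of_real t
        - (G (x + t) * cis (- M * t) - G (x - t) * cis (- (- M * t))) / of_real t) + k t)"
      by (rule integral_cong) (rule eq)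
    also have "\<dots> = 1 / (2 * pi * \<i>) * (J M - J (- M)) + integral {e..\<delta>} k"
    proof -
      note d = integrable_diff[OF intJ[of M] intJ[of "- M"]]
      show ?thesis
        unfolding J_def by (subst integral_add[OF integrable_on_mult_right[OF d] intk])
          (simp only: integral_mult_right integral_diff[OF intJ intJ])
    qed
    finally have "norm (?I e \<delta>) \<le> norm (1 / (2 * pi * \<i>) * (J M - J (- M))) + norm (integral {e..\<delta>} k)"
      by (simp only: norm_triangle_ineq)
    moreover have "norm (1 / (2 * pi * \<i>) * (J M - J (- M))) \<le> C"
    proof -
      have J: "norm (J l) \<le> C" for l unfolding J_def by (rule C) (use e in auto)
      have C0: "0 \<le> C" using J[of 0] norm_ge_zero order_trans by blast
      have "norm (1 / (2 * pi * \<i>) * (J M - J (- M))) = norm (J M - J (- M)) / (2 * pi)"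
        by (simp add: norm_mult norm_divide)
      also have "\<dots> \<le> (C + C) / 2"
        using pi_gt3 C0 by (intro frac_le order_trans[OF norm_triangle_ineq4 add_mono[OF J J]]) auto
      finally show ?thesis by simp
    qed
    moreover have "norm (integral {e..\<delta>} k) \<le> pi"
    proof -
      have "norm (integral {e..\<delta>} k) \<le> integral {e..\<delta>} (\<lambda>t. 2 * pi)"
      proof (rule integral_norm_bound_integral[OF intk])
        fix t assume t: "t \<in> {e..\<delta>}"
        then have t': "0 < t" "t \<le> 1/2" using e \<delta> by auto
        have s: "t / 2 \<le> sin (pi * t)" "0 < sin (pi * t)" using sin_pi_ge[of t] sin_pi_pos[of t] t' by auto
        have "\<bar>1 / sin (pi * t) - 1 / (pi * t)\<bar> = \<bar>sin (pi * t) - pi * t\<bar> / (sin (pi * t) * (pi * t))"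
        proof -
          have "1 / sin (pi * t) - 1 / (pi * t) = - (sin (pi * t) - pi * t) / (sin (pi * t) * (pi * t))"
            using s t' by (simp add: field_simps)
          then show ?thesis using s t' by (simp add: abs_mult)
        qed
        also have "\<dots> \<le> ((pi * t)\<^sup>2 / 2) / (t / 2 * (pi * t))"
          using s t' by (intro frac_le abs_sin_diff_le mult_mono mult_pos_pos) auto
        also have "\<dots> = pi" using t' by (simp add: power2_eq_square)
        finally have "\<bar>sin (M * t)\<bar> * \<bar>1 / sin (pi * t) - 1 / (pi * t)\<bar> \<le> 1 * pi"
          by (intro mult_mono) auto
        then show "norm (k t) \<le> 2 * pi"
          unfolding k_def norm_mult norm_of_real abs_mult by (intro mult_mono F2) auto
      qed (rule integrable_const_ivl)
      also have "\<dots> = (\<delta> - e) * 2 * pi" using e by simp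
      also have "\<dots> \<le> 1 * pi" using e \<delta> by (intro mult_right_mono) auto
      finally show ?thesis by simp
    qed
    ultimately show ?thesis by linarith
  qed
  have "fourier_partial_sum g N (circle_exp x) = ?I 0 (1/2)"
    using c by (simp add: fourier_partial_sum_dirichlet F_def G_def)
  also have "\<dots> = ?I 0 e + (?I e \<delta> + ?I \<delta> (1/2))"
    using e \<delta> int by (simp add: Henstock_Kurzweil_Integration.integral_combine)
  also have "norm \<dots> \<le> norm (?I 0 e) + (norm (?I e \<delta>) + norm (?I \<delta> (1/2)))"
    by (intro order_trans[OF norm_triangle_ineq] add_mono order_refl norm_triangle_ineq)
  also have "\<dots> \<le> 1 + 2 / \<delta> + C + pi" using I1 I2 I3 by linarith
  finally show ?thesis .
qed

lemma norm_integral_sin_le: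
  assumes "0 < M" "a \<le> b"
  shows "norm (integral {a..b} (\<lambda>t. complex_of_real (sin (M * t)))) \<le> 2 / M"
proof -
  have "((\<lambda>t. sin (M * t)) has_integral (- cos (M * b) / M - (- cos (M * a) / M))) {a..b}"
    using assms by (intro fundamental_theorem_of_calculus)
      (auto intro!: derivative_eq_intros simp: has_real_derivative_iff_has_vector_derivative[symmetric])
  then have I: "((\<lambda>t. complex_of_real (sin (M * t))) has_integral
      complex_of_real (- cos (M * b) / M - (- cos (M * a) / M))) {a..b}"
    by (rule has_integral_of_real)
  have "norm (integral {a..b} (\<lambda>t. complex_of_real (sin (M * t)))) = \<bar>- cos (M * b) / M - (- cos (M * a) / M)\<bar>"
    unfolding integral_unique[OF I] norm_of_real ..
  also have "\<dots> = \<bar>cos (M * a) - cos (M * b)\<bar> / M"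
    using assms by (simp add: field_simps)
  also have "\<dots> \<le> 2 / M"
    using assms abs_cos_le_one[of "M * a"] abs_cos_le_one[of "M * b"]
    by (intro divide_right_mono) (auto simp only: abs_le_iff)
  finally show ?thesis .
qed

lemma fourier_partial_sum_tendsto_C1:
  fixes g :: "complex \<Rightarrow> complex"
  defines "G t \<equiv> g (circle_exp t)"
  assumes d: "\<And>t. (G has_vector_derivative G' t) (at t)" and c': "continuous_on UNIV G'"
    and eps: "0 < \<epsilon>"
  shows "\<exists>N0. \<forall>N\<ge>N0. \<forall>x\<in>{0..1}. norm (fourier_partial_sum g N (circle_exp x) - G x) \<le> \<epsilon>"
proof -
  have c: "continuous_on UNIV G"
    using d by (meson continuous_at_imp_continuous_on has_vector_derivative_continuous)
  have cG: "continuous_on S (\<lambda>t. G (f t))" "continuous_on S (\<lambda>t. G' (f t))"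
    if "continuous_on S f" for S and f :: "real \<Rightarrow> real"
    by (rule continuous_on_compose2[OF c that] continuous_on_compose2[OF c' that]; auto)+
  have "bounded (G' ` {-1..2})"
    by (intro compact_imp_bounded compact_continuous_image continuous_on_subset[OF c']) auto
  then obtain L where L: "0 < L" "\<And>t. t \<in> {-1..2} \<Longrightarrow> norm (G' t) \<le> L"
    unfolding bounded_pos by blast
  have lip: "norm (G u - G v) \<le> L * \<bar>u - v\<bar>" if "u \<in> {-1..2}" "v \<in> {-1..2}" for u v
  proof -
    have "norm (G u - G v) \<le> L * norm (u - v)"
    proof (rule differentiable_bound[of "{-1..2::real}"])
      fix t assume t: "t \<in> {-1..2::real}"
      show "(G has_derivative (\<lambda>h. h *\<^sub>R G' t)) (at t within {-1..2})"
        using d[of t] by (auto simp: has_vector_derivative_def intro: has_derivative_at_withinI)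
      show "onorm (\<lambda>h. h *\<^sub>R G' t) \<le> L"
        by (rule onorm_le) (simp add: mult.commute[of L] mult_left_mono L(2)[OF t])
    qed (use that in auto)
    then show ?thesis by simp
  qed
  define \<eta> where "\<eta> = min (1/4) (\<epsilon> / (8 * L))"
  have \<eta>: "0 < \<eta>" "\<eta> \<le> 1/4" using eps L by (auto simp: \<eta>_def)
  have "\<eta> \<le> \<epsilon> / (8 * L)" by (simp add: \<eta>_def)
  then have \<eta>L: "4 * L * \<eta> \<le> \<epsilon> / 2" using L by (simp add: field_simps)
  define K where "K = 2 * L / (\<eta> / 2) + L * pi / (\<eta> / 2)\<^sup>2"
  have K0: "0 \<le> K" using L \<eta> by (auto simp: K_def)
  obtain N0 :: nat where N0: "2 * (L + K) / (\<epsilon> / 2) \<le> real N0" using real_arch_simple by blast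
  have "norm (fourier_partial_sum g N (circle_exp x) - G x) \<le> \<epsilon>" if N: "N0 \<le> N" and x: "x \<in> {0..1}" for N x
  proof -
    define M where "M = (2 * real N + 1) * pi"
    have M: "0 < M" "real N \<le> M"
    proof -
      show "0 < M" by (auto simp: M_def intro!: mult_pos_pos)
      have "real N * 1 \<le> (2 * real N + 1) * pi" using pi_gt3 by (intro mult_mono) auto
      then show "real N \<le> M" by (simp add: M_def)
    qed
    define F where "F t = G (x + t) + G (x - t) - 2 * G x" for t
    have cF: "continuous_on S F" for S unfolding F_def by (intro continuous_intros cG)
    have F: "norm (F t) \<le> 2 * L * t" if "t \<in> {0..1/2}" for t
    proof -
      have "F t = (G (x + t) - G x) + (G (x - t) - G x)" by (simp add: F_def)
      moreover have "norm (G (x + t) - G x) \<le> L * t" "norm (G (x - t) - G x) \<le> L * t"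
        using lip[of "x + t" x] lip[of "x - t" x] that x by auto
      ultimately show ?thesis
        using norm_triangle_ineq[of "G (x + t) - G x" "G (x - t) - G x"] by simp
    qed
    have int: "(\<lambda>t. F t * dirichlet N t) integrable_on {a..b}" for a b
      by (intro integrable_continuous_real continuous_intros cF)
    let ?I = "\<lambda>a b. integral {a..b} (\<lambda>t. F t * dirichlet N t)"
    have "integral {0..1/2} (\<lambda>t. 2 * G x * dirichlet N t) = G x"
      by (simp only: integral_mult_right integral_dirichlet) simp
    then have "fourier_partial_sum g N (circle_exp x) - G x
        = integral {0..1/2} (\<lambda>t. (G (x + t) + G (x - t)) * dirichlet N t) - integral {0..1/2} (\<lambda>t. 2 * G x * dirichlet N t)"
      using c by (simp add: fourier_partial_sum_dirichlet G_def)
    also have "\<dots> = ?I 0 (1/2)"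
      unfolding F_def left_diff_distrib
      by (intro integral_diff[symmetric] integrable_continuous_real continuous_intros cG)
    also have "\<dots> = ?I 0 \<eta> + ?I \<eta> (1/2)"
      using \<eta> int by (simp add: Henstock_Kurzweil_Integration.integral_combine)
    finally have eq: "fourier_partial_sum g N (circle_exp x) - G x = ?I 0 \<eta> + ?I \<eta> (1/2)" .
    have "norm (?I 0 \<eta>) \<le> integral {0..\<eta>} (\<lambda>t. 4 * L)"
    proof (rule integral_norm_bound_integral[OF int])
      fix t assume t: "t \<in> {0..\<eta>}"
      show "norm (F t * dirichlet N t) \<le> 4 * L"
      proof (cases "t = 0")
        case False
        with t \<eta> have t': "0 < t" "t \<le> 1/2" by auto
        then have "norm (F t * dirichlet N t) \<le> (2 * L * t) * (2 / t)"
          unfolding norm_mult by (intro mult_mono F norm_dirichlet_le_inverse) (use L in auto)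
        then show ?thesis using t' by simp
      qed (use F[of 0] L in auto)
    qed (rule integrable_const_ivl)
    also have "\<dots> \<le> \<epsilon> / 2" using \<eta> \<eta>L by (simp add: mult_ac)
    finally have near: "norm (?I 0 \<eta>) \<le> \<epsilon> / 2" .
    define h where "h t = F t * of_real (inverse (sin (pi * t)))" for t
    define h' where "h' t = F t * of_real (- (pi * cos (pi * t) / (sin (pi * t))\<^sup>2))
        + (G' (x + t) - G' (x - t)) * of_real (inverse (sin (pi * t)))" for t
    have s: "\<eta> / 2 \<le> sin (pi * t)" if "t \<in> {\<eta>..1/2}" for t
      using sin_pi_ge[of t] that \<eta> by auto
    then have s0: "0 < sin (pi * t)" if "t \<in> {\<eta>..1/2}" for t using that \<eta> by force
    have "norm (integral {\<eta>..1/2} (\<lambda>t. h t * of_real (sin (M * t))))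
        \<le> (2 / M) * (norm (h (1/2)) + integral {\<eta>..1/2} (\<lambda>_. K))"
    proof (rule weighted_integral_bound)
      fix t assume t: "t \<in> {\<eta>..1/2}"
      have "((\<lambda>t. inverse (sin (pi * t))) has_real_derivative - (pi * cos (pi * t) / (sin (pi * t))\<^sup>2)) (at t)"
        using s0[OF t] by (auto intro!: derivative_eq_intros simp: power2_eq_square field_simps)
      then have 1: "((\<lambda>t. complex_of_real (inverse (sin (pi * t)))) has_vector_derivative
          of_real (- (pi * cos (pi * t) / (sin (pi * t))\<^sup>2))) (at t)"
        by (intro has_vector_derivative_of_real) (simp add: has_real_derivative_iff_has_vector_derivative)
      have "((\<lambda>t. G (x + t)) has_vector_derivative 1 *\<^sub>R G' (x + t)) (at t)"
      proof -
        have "((\<lambda>t. x + t) has_vector_derivative 1) (at t)" by (auto intro!: derivative_eq_intros)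
        from vector_diff_chain_at[OF this, of G "G' (x + t)"] d show ?thesis by (simp add: o_def)
      qed
      moreover have "((\<lambda>t. G (x - t)) has_vector_derivative (-1) *\<^sub>R G' (x - t)) (at t)"
      proof -
        have "((\<lambda>t. x - t) has_vector_derivative -1) (at t)" by (auto intro!: derivative_eq_intros)
        from vector_diff_chain_at[OF this, of G "G' (x - t)"] d show ?thesis by (simp add: o_def)
      qed
      ultimately have 2: "(F has_vector_derivative (G' (x + t) - G' (x - t))) (at t)"
        unfolding F_def by (auto intro!: derivative_eq_intros)
      show "(h has_vector_derivative h' t) (at t)"
        unfolding h_def h'_def by (rule has_vector_derivative_mult[OF 2 1])
      have "norm (h' t) \<le> norm (F t) * (pi * \<bar>cos (pi * t)\<bar> / (sin (pi * t))\<^sup>2)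
          + norm (G' (x + t) - G' (x - t)) * (1 / sin (pi * t))"
        unfolding h'_def using s0[OF t]
        by (intro order_trans[OF norm_triangle_ineq])
          (simp add: norm_mult norm_divide norm_inverse norm_power inverse_eq_divide)
      also have "\<dots> \<le> L * (pi * 1 / (\<eta> / 2)\<^sup>2) + (2 * L) * (1 / (\<eta> / 2))"
      proof (intro add_mono mult_mono frac_le power_mono s t)
        have "2 * L * t \<le> 2 * L * (1/2)" using t L by (intro mult_left_mono) auto
        then show "norm (F t) \<le> L" using F[of t] t \<eta> by auto
        have "norm (G' (x + t)) \<le> L" "norm (G' (x - t)) \<le> L" using L(2) t x \<eta> by auto
        then show "norm (G' (x + t) - G' (x - t)) \<le> 2 * L"
          using norm_triangle_ineq4[of "G' (x + t)" "G' (x - t)"] by linarith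
      qed (use \<eta> L s0[OF t] in auto)
      also have "\<dots> = K" by (simp add: K_def)
      finally show "norm (h' t) \<le> K" .
    next
      show "continuous_on {\<eta>..1/2} h'"
        unfolding h'_def by (intro continuous_intros cF cG) (use s0 in force)+
      show "norm (integral {\<eta>..r} (\<lambda>t. complex_of_real (sin (M * t)))) \<le> 2 / M" if "r \<in> {\<eta>..1/2}" for r
        using that M by (intro norm_integral_sin_le) auto
    qed (use \<eta> in \<open>auto intro!: continuous_intros\<close>)
    also have "integral {\<eta>..1/2} (\<lambda>t. h t * of_real (sin (M * t))) = ?I \<eta> (1/2)"
    proof (rule integral_cong)
      fix t assume t: "t \<in> {\<eta>..1/2}"
      then have "dirichlet N t = of_real (sin (M * t) / sin (pi * t))"
        using \<eta> by (subst dirichlet_eq) (auto simp: M_def mult_ac)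
      then show "h t * of_real (sin (M * t)) = F t * dirichlet N t"
        by (simp add: h_def field_simps)
    qed
    finally have "norm (?I \<eta> (1/2)) \<le> (2 / M) * (norm (h (1/2)) + integral {\<eta>..1/2} (\<lambda>_. K))" .
    also have "\<dots> \<le> (2 / M) * (L + K)"
    proof -
      have "norm (h (1/2)) \<le> L" using F[of "1/2"] by (simp add: h_def norm_mult)
      moreover have "integral {\<eta>..1/2} (\<lambda>_. K) \<le> 1 * K"
        using \<eta> K0 by (simp add: mult_left_le_one_le)
      ultimately show ?thesis using M by (intro mult_left_mono) auto
    qed
    also have "\<dots> \<le> \<epsilon> / 2"
    proof -
      have "2 * (L + K) / (\<epsilon> / 2) \<le> M" using N0 N M(2) by linarith
      then show ?thesis using eps M(1) by (simp add: field_simps)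
    qed
    finally have "norm (?I \<eta> (1/2)) \<le> \<epsilon> / 2" .
    with near show ?thesis
      unfolding eq using norm_triangle_ineq[of "?I 0 \<eta>" "?I \<eta> (1/2)"] by linarith
  qed
  then show ?thesis by blast
qed

subsection \<open>Absolutely convergent Fourier series on the torus\<close>

definition torus_char :: "int ^ 'd \<Rightarrow> complex ^ 'd \<Rightarrow> complex" where
  "torus_char n z = (\<Prod>j\<in>UNIV. (z $ j) powi (n $ j))"

lemma torus_norm: "z \<in> torus \<Longrightarrow> norm (z $ j) = 1"
  by (simp add: torus_def circle_def)

lemma torus_nonzero: "z \<in> torus \<Longrightarrow> z $ j \<noteq> 0"
  using torus_norm[of z j] by auto

lemma torus_exp_in_torus: "torus_exp x \<in> torus"
  by (simp add: torus_def torus_exp_def circle_exp_in_circle)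

lemma torus_subset_image: "torus \<subseteq> torus_exp ` cbox 0 (1 :: real ^ 'd)"
proof
  fix z :: "complex ^ 'd" assume "z \<in> torus"
  then have "z $ j \<in> circle_exp ` {0..1}" for j
    by (simp add: torus_def circle_eq_image[symmetric])
  then have "\<exists>t. 0 \<le> t \<and> t \<le> 1 \<and> z $ j = circle_exp t" for j
    by (metis (no_types, lifting) atLeastAtMost_iff imageE)
  then obtain x where x: "\<And>j. 0 \<le> x j \<and> x j \<le> 1 \<and> z $ j = circle_exp (x j)" by metis
  have "z = torus_exp (\<chi> j. x j)" by (simp add: torus_exp_def vec_eq_iff x)
  moreover have "(\<chi> j. x j) \<in> cbox 0 (1 :: real ^ 'd)" by (simp add: mem_box_cart x)
  ultimately show "z \<in> torus_exp ` cbox 0 1" by blast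
qed

lemma continuous_on_torus_exp: "continuous_on S torus_exp"
  unfolding torus_exp_def circle_exp_cis by (intro continuous_intros)

lemma compact_torus: "compact (torus :: (complex ^ 'd) set)"
proof -
  have "torus = torus_exp ` cbox 0 (1 :: real ^ 'd)"
    using torus_subset_image torus_exp_in_torus by blast
  then show ?thesis by (metis compact_continuous_image continuous_on_torus_exp compact_cbox)
qed

lemma continuous_on_torus_char: "continuous_on torus (torus_char n)"
  unfolding torus_char_def by (intro continuous_intros) (auto simp: torus_nonzero)

lemma norm_torus_char: "z \<in> torus \<Longrightarrow> norm (torus_char n z) = 1"
  by (simp add: torus_char_def prod_norm[symmetric] norm_power_int torus_norm)

lemma torus_char_add: "z \<in> torus \<Longrightarrow> torus_char (m + n) z = torus_char m z * torus_char n z"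
  by (simp add: torus_char_def power_int_add torus_nonzero prod.distrib)

lemma torus_char_uminus: "z \<in> torus \<Longrightarrow> torus_char (- n) z = cnj (torus_char n z)"
proof -
  assume z: "z \<in> torus"
  have "torus_char n z * torus_char (- n) z = 1"
    using torus_char_add[OF z, of n "- n"] by (simp add: torus_char_def)
  moreover have "torus_char n z * cnj (torus_char n z) = 1"
    using norm_torus_char[OF z, of n] by (simp add: complex_norm_square[symmetric])
  ultimately show ?thesis by (metis mult_cancel_left mult_zero_left zero_neq_one)
qed

lemma torus_char_zero [simp]: "torus_char 0 z = 1"
  by (simp add: torus_char_def)

lemma torus_char_axis: "torus_char (axis j 1) z = z $ j"
proof -
  have "(z $ i) powi (axis j (1 :: int) $ i) = (if i = j then z $ i else 1)" for i
    by (simp add: axis_def)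
  then show ?thesis by (simp add: torus_char_def)
qed

lemma torus_char_exp: "torus_char n (torus_exp x) = cis (2 * pi * (\<Sum>j\<in>UNIV. of_int (n $ j) * x $ j))"
proof -
  have "torus_char n (torus_exp x) = (\<Prod>j\<in>UNIV. cis (of_int (n $ j) * (2 * pi * x $ j)))"
    by (simp add: torus_char_def torus_exp_def circle_exp_cis cis_power_int)
  also have "\<dots> = cis (\<Sum>j\<in>UNIV. of_int (n $ j) * (2 * pi * x $ j))"
    by (simp add: cis_conv_exp exp_sum[symmetric] sum_distrib_left)
  finally show ?thesis by (simp add: sum_distrib_left mult_ac)
qed

lemma lborel_integral_prod:
  fixes f :: "'a::euclidean_space \<Rightarrow> real \<Rightarrow> complex"
  assumes f: "\<And>b. b \<in> Basis \<Longrightarrow> integrable lborel (f b)"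
  shows "(\<integral>x. (\<Prod>b\<in>Basis. f b (x \<bullet> b)) \<partial>lborel) = (\<Prod>b\<in>Basis. \<integral>t. f b t \<partial>lborel)"
proof -
  interpret product_sigma_finite "\<lambda>_::'a. lborel :: real measure" ..
  have [measurable]: "f b \<in> borel_measurable borel" if "b \<in> Basis" for b
    using borel_measurable_integrable[OF f[OF that]] by simp
  have "(\<integral>x. (\<Prod>b\<in>Basis. f b (x \<bullet> b)) \<partial>lborel)
      = (\<integral>y. (\<Prod>b\<in>Basis. f b ((\<Sum>b\<in>Basis. y b *\<^sub>R b) \<bullet> b)) \<partial>(\<Pi>\<^sub>M b\<in>(Basis::'a set). lborel))"
    unfolding lborel_eq[where 'a='a] by (rule integral_distr) measurable
  also have "\<dots> = (\<integral>y. (\<Prod>b\<in>Basis. f b (y b)) \<partial>(\<Pi>\<^sub>M b\<in>(Basis::'a set). lborel))"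
    by (intro Bochner_Integration.integral_cong prod.cong) (auto simp: inner_sum_left_Basis)
  also have "\<dots> = (\<Prod>b\<in>Basis. \<integral>t. f b t \<partial>lborel)"
    by (rule product_integral_prod[OF finite_Basis f])
  finally show ?thesis .
qed

lemma set_integrable_cbox:
  fixes f :: "'a::euclidean_space \<Rightarrow> complex"
  assumes "continuous_on (cbox a b) f"
  shows "set_integrable lborel (cbox a b) f"
  unfolding set_integrable_def by (intro borel_integrable_compact compact_cbox assms)

lemma integral_torus_char:
  fixes n :: "int ^ 'd"
  shows "integral (cbox 0 1) (\<lambda>x. torus_char n (torus_exp x)) = (if n = 0 then 1 else 0)"
proof -
  define f where "f b t = indicator {0..1::real} t *\<^sub>R cis (2 * pi * of_int (n $ axis_index b) * t)"
    for b :: "real ^ 'd" and t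
  have f: "integrable lborel (f b)" for b
    unfolding f_def by (intro borel_integrable_compact continuous_intros) auto
  have fint: "(\<integral>t. f b t \<partial>lborel) = (if n $ axis_index b = 0 then 1 else 0)" for b
  proof -
    have "(\<integral>t. f b t \<partial>lborel) = integral {0..1} (\<lambda>t. cis (2 * pi * of_int (n $ axis_index b) * t))"
      unfolding f_def set_lebesgue_integral_def[symmetric]
      by (intro set_borel_integral_eq_integral borel_integrable_atLeastAtMost' continuous_intros)
    then show ?thesis using integral_cis_period[of "n $ axis_index b"] by simp
  qed
  have basis: "(Basis :: (real ^ 'd) set) = range (\<lambda>j. axis j 1)"
    unfolding Basis_vec_def by auto
  have inj: "inj (\<lambda>j. axis j 1 :: real ^ 'd)" by (auto simp: inj_on_def axis_eq_axis)
  have idx: "axis_index (axis j 1 :: real ^ 'd) = j" for j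
    unfolding axis_index_def by (rule some_equality) (auto simp: axis_eq_axis)
  have pr: "indicator (cbox 0 1) x *\<^sub>R torus_char n (torus_exp x) = (\<Prod>b\<in>Basis. f b (x \<bullet> b))" for x
  proof -
    have "(\<Prod>b\<in>Basis. f b (x \<bullet> b)) = (\<Prod>j\<in>UNIV. f (axis j 1) (x $ j))"
      unfolding basis by (subst prod.reindex[OF inj]) (simp add: inner_axis)
    also have "\<dots> = (\<Prod>j\<in>UNIV. of_real (indicator {0..1} (x $ j)) * cis (2 * pi * (of_int (n $ j) * x $ j)))"
      by (simp add: f_def idx scaleR_conv_of_real mult.assoc)
    also have "\<dots> = of_real (\<Prod>j\<in>UNIV. indicator {0..1} (x $ j)) * torus_char n (torus_exp x)"
      by (simp add: prod.distrib torus_char_exp cis_conv_exp exp_sum[symmetric] sum_distrib_left)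
    also have "(\<Prod>j\<in>UNIV. indicator {0..1} (x $ j)) = (indicator (cbox 0 1) x :: real)"
    proof (cases "x \<in> cbox 0 1")
      case True
      then show ?thesis by (simp add: mem_box_cart)
    next
      case False
      then obtain j where "x $ j \<notin> {0..1}" by (auto simp: mem_box_cart)
      then have "indicator {0..1} (x $ j) = (0 :: real)" by (rule indicator_simps)
      then have "(\<Prod>j\<in>UNIV. indicator {0..1} (x $ j) :: real) = 0"
        by (intro prod_zero bexI[of _ j]) auto
      then show ?thesis using False by simp
    qed
    finally show ?thesis by (simp add: scaleR_conv_of_real)
  qed
  have "continuous_on (cbox 0 1) (\<lambda>x :: real ^ 'd. torus_char n (torus_exp x))"
    unfolding torus_char_exp by (intro continuous_intros)
  then have "integral (cbox 0 1) (\<lambda>x. torus_char n (torus_exp x)) = (\<integral>x. (\<Prod>b\<in>Basis. f b (x \<bullet> b)) \<partial>lborel)"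
    unfolding pr[symmetric] set_lebesgue_integral_def[symmetric]
    by (intro set_borel_integral_eq_integral(2)[symmetric] set_integrable_cbox)
  also have "\<dots> = (\<Prod>b\<in>(Basis :: (real ^ 'd) set). if n $ axis_index b = 0 then 1 else 0)"
    by (simp add: lborel_integral_prod[OF f] fint)
  also have "\<dots> = (\<Prod>j\<in>UNIV. if n $ j = 0 then 1 else 0)"
    unfolding basis by (subst prod.reindex[OF inj]) (simp add: idx)
  also have "\<dots> = (if n = 0 then 1 else 0)"
  proof (cases "n = 0")
    case False
    then obtain j where "n $ j \<noteq> 0" by (auto simp: vec_eq_iff)
    then have "(\<Prod>j\<in>UNIV. if n $ j = 0 then 1 else 0 :: complex) = 0"
      by (intro prod_zero) (auto intro!: exI[of _ j])
    then show ?thesis using False by simp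
  qed simp
  finally show ?thesis .
qed

lemma continuous_on_torus_lift:
  "continuous_on torus h \<Longrightarrow> continuous_on S (\<lambda>x. h (torus_exp x))"
  by (rule continuous_on_compose2[OF _ continuous_on_torus_exp]) (auto simp: torus_exp_in_torus)

lemma integrable_torus_lift:
  fixes h :: "complex ^ 'd \<Rightarrow> complex"
  shows "continuous_on torus h \<Longrightarrow> (\<lambda>x. h (torus_exp x)) integrable_on cbox 0 1"
  by (intro integrable_continuous continuous_on_torus_lift)

lemma torus_fourier_coeff_integral:
  fixes f :: "complex ^ 'd \<Rightarrow> complex"
  assumes "continuous_on torus f"
  shows "torus_fourier_coeff f n = integral (cbox 0 1) (\<lambda>x. f (torus_exp x) * torus_char (- n) (torus_exp x))"
proof -
  have e: "exp (- (2 * pi * \<i> * complex_of_real (\<Sum>j\<in>UNIV. of_int (n $ j) * x $ j))) = torus_char (- n) (torus_exp x)"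
    for x :: "real ^ 'd"
    by (simp add: torus_char_exp cis_conv_exp sum_negf mult_ac)
  have "continuous_on (cbox 0 1) (\<lambda>x. f (torus_exp x) * torus_char (- n) (torus_exp x))"
    by (intro continuous_intros continuous_on_torus_lift continuous_on_torus_char assms)
  then show ?thesis
    unfolding torus_fourier_coeff_def e by (intro set_borel_integral_eq_integral set_integrable_cbox)
qed

inductive trig_poly :: "(complex ^ 'd \<Rightarrow> complex) \<Rightarrow> bool" where
  char: "trig_poly (\<lambda>z. c * torus_char n z)"
| add: "trig_poly p \<Longrightarrow> trig_poly q \<Longrightarrow> trig_poly (\<lambda>z. p z + q z)"

lemma continuous_on_trig_poly: "trig_poly p \<Longrightarrow> continuous_on torus p"
  by (induction rule: trig_poly.induct) (intro continuous_intros continuous_on_torus_char; simp)+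

lemma trig_poly_mult:
  assumes "trig_poly p" "trig_poly q"
  shows "\<exists>r. trig_poly r \<and> (\<forall>z\<in>torus. r z = p z * q z)"
  using assms(1)
proof (induction rule: trig_poly.induct)
  case (char c n)
  from assms(2) show ?case
  proof (induction rule: trig_poly.induct)
    case (char d m)
    show ?case
      by (rule exI[of _ "\<lambda>z. (c * d) * torus_char (n + m) z"])
        (auto simp: torus_char_add intro: trig_poly.char)
  next
    case (add p q)
    then obtain r s where "trig_poly r" "\<forall>z\<in>torus. r z = c * torus_char n z * p z"
      "trig_poly s" "\<forall>z\<in>torus. s z = c * torus_char n z * q z" by blast
    then show ?case
      by (intro exI[of _ "\<lambda>z. r z + s z"]) (auto simp: distrib_left intro: trig_poly.add)
  qed
next
  case (add p p')
  then obtain r s where "trig_poly r" "\<forall>z\<in>torus. r z = p z * q z"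
    "trig_poly s" "\<forall>z\<in>torus. s z = p' z * q z" by blast
  then show ?case
    by (intro exI[of _ "\<lambda>z. r z + s z"]) (auto simp: distrib_right intro: trig_poly.add)
qed

lemma trig_poly_cmult: "trig_poly p \<Longrightarrow> \<exists>r. trig_poly r \<and> (\<forall>z\<in>torus. r z = c * p z)"
  using trig_poly_mult[OF trig_poly.char[of c 0], of p] by simp

lemma trig_poly_approx_real:
  fixes h :: "complex ^ 'd \<Rightarrow> real"
  assumes "continuous_on torus h" "0 < e"
  shows "\<exists>p. trig_poly p \<and> (\<forall>z\<in>torus. norm (of_real (h z) - p z) < e)"
proof -
  define R where "R = {h :: complex ^ 'd \<Rightarrow> real. continuous_on torus h \<and>
    (\<exists>p. trig_poly p \<and> (\<forall>z\<in>torus. of_real (h z) = p z))}"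
  interpret function_ring_on R "torus :: (complex ^ 'd) set"
  proof
    fix f g assume "f \<in> R" "g \<in> R"
    then obtain p q where f: "continuous_on torus f" "trig_poly p" "\<forall>z\<in>torus. of_real (f z) = p z"
      and g: "continuous_on torus g" "trig_poly q" "\<forall>z\<in>torus. of_real (g z) = q z"
      by (auto simp: R_def)
    show "(\<lambda>x. f x + g x) \<in> R"
      using f g by (auto simp: R_def intro!: continuous_intros exI[of _ "\<lambda>z. p z + q z"] trig_poly.add)
    obtain r where "trig_poly r" "\<forall>z\<in>torus. r z = p z * q z" using trig_poly_mult f g by blast
    then show "(\<lambda>x. f x * g x) \<in> R"
      using f g by (auto simp: R_def intro!: continuous_intros exI[of _ r])
  next
    fix c show "(\<lambda>_. c) \<in> R"
      using trig_poly.char[of "of_real c" 0] by (auto simp: R_def)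
  next
    fix z w :: "complex ^ 'd" assume zw: "z \<in> torus" "w \<in> torus" "z \<noteq> w"
    then obtain j where "z $ j \<noteq> w $ j" by (auto simp: vec_eq_iff)
    then consider "Re (z $ j) \<noteq> Re (w $ j)" | "Im (z $ j) \<noteq> Im (w $ j)" by (auto simp: complex_eq_iff)
    then show "\<exists>f\<in>R. f z \<noteq> f w"
    proof cases
      case 1
      have "trig_poly (\<lambda>z. 1/2 * torus_char (axis j 1) z + 1/2 * torus_char (- axis j 1) z)"
        by (intro trig_poly.intros)
      moreover have "\<forall>z\<in>torus. of_real (Re (z $ j)) = 1/2 * torus_char (axis j 1) z + 1/2 * torus_char (- axis j 1) z"
        by (auto simp: torus_char_uminus torus_char_axis complex_eq_iff)
      ultimately have "(\<lambda>z. Re (z $ j)) \<in> R" by (auto simp: R_def intro!: continuous_intros)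
      then show ?thesis using 1 by (intro bexI[of _ "\<lambda>z. Re (z $ j)"])
    next
      case 2
      have "trig_poly (\<lambda>z. - \<i> / 2 * torus_char (axis j 1) z + \<i> / 2 * torus_char (- axis j 1) z)"
        by (intro trig_poly.intros)
      moreover have "\<forall>z\<in>torus. of_real (Im (z $ j)) = - \<i> / 2 * torus_char (axis j 1) z + \<i> / 2 * torus_char (- axis j 1) z"
        by (auto simp: torus_char_uminus torus_char_axis complex_eq_iff)
      ultimately have "(\<lambda>z. Im (z $ j)) \<in> R" by (auto simp: R_def intro!: continuous_intros)
      then show ?thesis using 2 by (intro bexI[of _ "\<lambda>z. Im (z $ j)"])
    qed
  qed (auto simp: R_def compact_torus)
  obtain g where g: "g \<in> R" "\<forall>z\<in>torus. \<bar>h z - g z\<bar> < e"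
    using Stone_Weierstrass_basic[OF assms] by blast
  then obtain p where p: "trig_poly p" "\<forall>z\<in>torus. of_real (g z) = p z" by (auto simp: R_def)
  have "norm (of_real (h z) - p z) < e" if "z \<in> torus" for z
    using g(2) p(2) that by (metis norm_of_real of_real_diff)
  then show ?thesis using p(1) by blast
qed

lemma torus_fourier_unique:
  fixes h :: "complex ^ 'd \<Rightarrow> complex"
  assumes h: "continuous_on torus h"
    and 0: "\<And>n. integral (cbox 0 1) (\<lambda>x. h (torus_exp x) * torus_char n (torus_exp x)) = 0"
    and z: "z \<in> torus"
  shows "h z = 0"
proof -
  have "bounded (h ` torus)"
    by (intro compact_imp_bounded compact_continuous_image h compact_torus)
  then obtain B where B: "0 < B" "\<And>z. z \<in> torus \<Longrightarrow> norm (h z) \<le> B" unfolding bounded_pos by blast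
  have orth: "integral (cbox 0 1) (\<lambda>x. h (torus_exp x) * p (torus_exp x)) = 0" if "trig_poly p" for p
    using that
  proof (induction rule: trig_poly.induct)
    case (char c n)
    have "integral (cbox 0 1) (\<lambda>x. c * (h (torus_exp x) * torus_char n (torus_exp x))) = 0"
      by (simp only: integral_mult_right 0 mult_zero_right)
    then show ?case by (simp add: mult_ac)
  next
    case (add p q)
    have "(\<lambda>x. h (torus_exp x) * p (torus_exp x)) integrable_on cbox 0 1"
      "(\<lambda>x. h (torus_exp x) * q (torus_exp x)) integrable_on cbox 0 1"
      by (intro integrable_torus_lift[of "\<lambda>z. h z * p z"] integrable_torus_lift[of "\<lambda>z. h z * q z"]
          continuous_intros h continuous_on_trig_poly add)+
    then show ?case by (simp add: distrib_left integral_add add.IH)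
  qed
  define F where "F x = (norm (h (torus_exp x)))\<^sup>2" for x
  have cF: "continuous_on S F" for S
    unfolding F_def by (intro continuous_intros continuous_on_torus_lift h)
  have box1: "box 0 (1 :: real ^ 'd) \<noteq> {}" "cbox 0 (1 :: real ^ 'd) \<noteq> {}"
    by (simp_all add: interval_ne_empty_cart)
  then have content1: "measure lborel (cbox 0 (1 :: real ^ 'd)) = 1"
    by (simp add: content_cbox_cart)
  have small: "\<bar>integral (cbox 0 1) F\<bar> \<le> B * (2 * e)" if e: "0 < e" for e
  proof -
    have cRe: "continuous_on torus (\<lambda>z. Re (h z))" and cIm: "continuous_on torus (\<lambda>z. Im (h z))"
      by (intro continuous_intros h)+
    obtain p where p: "trig_poly p" "\<And>z. z \<in> torus \<Longrightarrow> norm (of_real (Re (h z)) - p z) < e"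
      using trig_poly_approx_real[OF cRe e] by blast
    obtain q where q: "trig_poly q" "\<And>z. z \<in> torus \<Longrightarrow> norm (of_real (Im (h z)) - q z) < e"
      using trig_poly_approx_real[OF cIm e] by blast
    obtain q' where q': "trig_poly q'" "\<And>z. z \<in> torus \<Longrightarrow> q' z = - \<i> * q z"
      using trig_poly_cmult[OF q(1), of "- \<i>"] by blast
    define r where "r z = p z + q' z" for z
    have r: "trig_poly r" unfolding r_def by (intro trig_poly.add p q')
    have rn: "norm (cnj (h z) - r z) \<le> 2 * e" if "z \<in> torus" for z
    proof -
      have "cnj (h z) - r z = (of_real (Re (h z)) - p z) - \<i> * (of_real (Im (h z)) - q z)"
        using q'(2)[OF that] by (simp add: r_def complex_eq_iff)
      then have "norm (cnj (h z) - r z) \<le> norm (of_real (Re (h z)) - p z) + norm (\<i> * (of_real (Im (h z)) - q z))"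
        by (simp only:) (rule norm_triangle_ineq4)
      then show ?thesis using p(2)[OF that] q(2)[OF that] by (simp add: norm_mult)
    qed
    have i1: "(\<lambda>x. h (torus_exp x) * (cnj (h (torus_exp x)) - r (torus_exp x))) integrable_on cbox 0 1"
      and i2: "(\<lambda>x. h (torus_exp x) * r (torus_exp x)) integrable_on cbox 0 1"
      by (intro integrable_torus_lift[of "\<lambda>z. h z * (cnj (h z) - r z)"] integrable_torus_lift[of "\<lambda>z. h z * r z"]
          continuous_intros h continuous_on_trig_poly r)+
    have "complex_of_real (integral (cbox 0 1) F) = integral (cbox 0 1) (\<lambda>x. of_real (F x))"
      using integrable_continuous[OF cF] by (simp add: integral_linear[OF _ bounded_linear_of_real, unfolded o_def])
    also have "\<dots> = integral (cbox 0 1) (\<lambda>x. h (torus_exp x) * (cnj (h (torus_exp x)) - r (torus_exp x))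
        + h (torus_exp x) * r (torus_exp x))"
      unfolding F_def complex_norm_square by (simp add: algebra_simps)
    also have "\<dots> = integral (cbox 0 1) (\<lambda>x. h (torus_exp x) * (cnj (h (torus_exp x)) - r (torus_exp x)))"
      by (simp only: integral_add[OF i1 i2] orth[OF r] add_0_right)
    also have "norm \<dots> \<le> integral (cbox 0 1) (\<lambda>x :: real ^ 'd. B * (2 * e))"
      by (rule integral_norm_bound_integral[OF i1])
        (auto simp: norm_mult intro!: mult_mono B(2) rn torus_exp_in_torus less_imp_le[OF B(1)])
    also have "\<dots> = B * (2 * e)" by (simp add: content1)
    finally show ?thesis by simp
  qed
  have "integral (cbox 0 1) F = 0"
  proof (rule ccontr)
    assume "integral (cbox 0 1) F \<noteq> 0"
    then have "0 < \<bar>integral (cbox 0 1) F\<bar> / (4 * B)" using B(1) by simp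
    from small[OF this] show False using B(1) \<open>integral (cbox 0 1) F \<noteq> 0\<close> by (simp add: field_simps)
  qed
  then have "\<forall>x\<in>cbox 0 1. F x = 0"
    using integral_cbox_eq_0_iff[OF cF box1(1)] by (simp add: F_def)
  then show ?thesis using torus_subset_image z by (auto simp: F_def)
qed

lemma A_space_expansion:
  fixes f :: "complex ^ 'd \<Rightarrow> complex"
  assumes f: "f \<in> A_space"
  shows "uniform_limit torus (\<lambda>A z. \<Sum>n\<in>A. torus_fourier_coeff f n * torus_char n z) f (finite_subsets_at_top UNIV)"
proof -
  define c where "c n = torus_fourier_coeff f n" for n
  define s where "s A z = (\<Sum>n\<in>A. c n * torus_char n z)" for A z
  define S where "S z = (\<Sum>\<^sub>\<infinity>n. c n * torus_char n z)" for z
  have cf: "continuous_on torus f" and sm: "(\<lambda>n. norm (c n)) summable_on UNIV"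
    using f by (auto simp: A_space_def c_def)
  have lim: "uniform_limit torus s S (finite_subsets_at_top UNIV)"
    unfolding s_def S_def using sm
    by (intro Weierstrass_m_test_general[where M = "\<lambda>n. norm (c n)"]) (simp_all add: norm_mult norm_torus_char)
  have cs: "continuous_on torus (s A)" for A
    unfolding s_def by (intro continuous_intros continuous_on_torus_char)
  have cS: "continuous_on torus S"
    by (rule uniform_limit_theorem[OF always_eventually lim]) (simp_all add: cs)
  have int: "(\<lambda>x. h (torus_exp x) * torus_char m (torus_exp x)) integrable_on cbox 0 1"
    if "continuous_on torus h" for h and m :: "int ^ 'd"
    by (intro integrable_torus_lift[of "\<lambda>z. h z * torus_char m z"] continuous_intros that continuous_on_torus_char)
  have fint: "integral (cbox 0 1) (\<lambda>x. f (torus_exp x) * torus_char m (torus_exp x)) = c (- m)" for m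
    using torus_fourier_coeff_integral[OF cf, of "- m"] by (simp add: c_def)
  have sint: "integral (cbox 0 1) (\<lambda>x. s A (torus_exp x) * torus_char m (torus_exp x)) = c (- m)"
    if A: "finite A" "- m \<in> A" for A m
  proof -
    have "integral (cbox 0 1) (\<lambda>x. s A (torus_exp x) * torus_char m (torus_exp x))
        = integral (cbox 0 1) (\<lambda>x. \<Sum>n\<in>A. c n * torus_char (n + m) (torus_exp x))"
      by (simp add: s_def sum_distrib_right torus_char_add torus_exp_in_torus mult.assoc)
    also have "\<dots> = (\<Sum>n\<in>A. c n * integral (cbox 0 1) (\<lambda>x. torus_char (n + m) (torus_exp x)))"
      by (subst integral_sum)
        (auto intro!: A integrable_torus_lift continuous_intros continuous_on_torus_char)
    also have "\<dots> = (\<Sum>n\<in>A. if n = - m then c n else 0)"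
      by (rule sum.cong) (auto simp: integral_torus_char add_eq_0_iff2)
    finally show ?thesis using A by simp
  qed
  have "S z = f z" if z: "z \<in> torus" for z
  proof -
    have "f z - S z = 0"
    proof (rule torus_fourier_unique[OF _ _ z])
      show "continuous_on torus (\<lambda>z. f z - S z)" by (intro continuous_intros cf cS)
      fix m :: "int ^ 'd"
      let ?J = "integral (cbox 0 1) (\<lambda>x. (f (torus_exp x) - S (torus_exp x)) * torus_char m (torus_exp x))"
      have J: "norm ?J \<le> e" if e: "0 < e" for e
      proof -
        have "\<forall>\<^sub>F A in finite_subsets_at_top UNIV. \<forall>z\<in>torus. dist (s A z) (S z) < e"
          using uniform_limitD[OF lim e] .
        then obtain X where X: "finite X" "\<And>A. finite A \<Longrightarrow> X \<subseteq> A \<Longrightarrow> \<forall>z\<in>torus. dist (s A z) (S z) < e"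
          unfolding eventually_finite_subsets_at_top by auto
        define A where "A = insert (- m) X"
        have A: "finite A" "- m \<in> A" "\<And>z. z \<in> torus \<Longrightarrow> dist (s A z) (S z) < e"
          using X by (auto simp: A_def)
        have cd: "continuous_on torus (\<lambda>z. s A z - S z)" by (intro continuous_intros cs cS)
        have "?J = integral (cbox 0 1) (\<lambda>x. f (torus_exp x) * torus_char m (torus_exp x))
            - integral (cbox 0 1) (\<lambda>x. S (torus_exp x) * torus_char m (torus_exp x))"
          unfolding left_diff_distrib by (intro integral_diff int cf cS)
        also have "\<dots> = integral (cbox 0 1) (\<lambda>x. s A (torus_exp x) * torus_char m (torus_exp x))
            - integral (cbox 0 1) (\<lambda>x. S (torus_exp x) * torus_char m (torus_exp x))"
          by (simp only: fint sint[OF A(1,2)])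
        also have "\<dots> = integral (cbox 0 1) (\<lambda>x. (s A (torus_exp x) - S (torus_exp x)) * torus_char m (torus_exp x))"
          unfolding left_diff_distrib by (intro integral_diff[symmetric] int cs cS)
        also have "norm \<dots> \<le> integral (cbox 0 1) (\<lambda>x :: real ^ 'd. e)"
          using A(3) by (intro integral_norm_bound_integral int[OF cd])
            (auto simp: norm_mult norm_torus_char torus_exp_in_torus dist_norm intro: less_imp_le)
        also have "\<dots> = e" by (simp add: content_cbox_cart interval_ne_empty_cart)
        finally show ?thesis .
      qed
      have "norm ?J \<le> 0"
        by (rule field_le_epsilon) (use J in \<open>simp only: add_0_left\<close>)
      then show "?J = 0" by (simp only: norm_le_zero_iff)
    qed
    then show ?thesis by simp
  qed
  then have "uniform_limit torus s f (finite_subsets_at_top UNIV)"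
    using uniform_limit_cong'[of torus s s S f] lim by simp
  then show ?thesis by (simp add: s_def[abs_def] c_def)
qed

subsection \<open>Characters composed with an analytic map\<close>

lemma circle_map_local_data:
  fixes \<Phi> :: "complex \<Rightarrow> complex ^ 'd"
  assumes "real_analytic_circle_map \<Phi>"
  shows "\<exists>r a (\<psi> :: real \<Rightarrow> (real ^ 'd) \<times> real). 0 < r \<and>
    (\<forall>t\<in>ball x0 r. (\<lambda>k. (t - x0) ^ k *\<^sub>R a k) sums \<psi> t) \<and>
    (\<forall>t\<in>ball x0 r. \<forall>n l. torus_char n (\<Phi> (circle_exp t)) * cis (l * t)
      = cis ((2 * pi *\<^sub>R (\<chi> j. of_int (n $ j)), l) \<bullet> \<psi> t))"
proof -
  have "\<exists>\<delta>>0. \<exists>\<phi>. \<phi> real_analytic_on ball x0 \<delta> \<and>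
      (\<forall>t\<in>ball x0 \<delta>. \<Phi> (circle_exp t) = torus_exp (\<phi> t))"
    using assms by (simp add: real_analytic_circle_map_def)
  then obtain \<delta> \<phi> where \<delta>: "0 < \<delta>" "\<phi> real_analytic_on ball x0 \<delta>"
    "\<forall>t\<in>ball x0 \<delta>. \<Phi> (circle_exp t) = torus_exp (\<phi> t)"
    by (elim exE conjE)
  have "\<exists>a r. r > 0 \<and> (\<forall>t\<in>ball x0 r. (\<lambda>k. (t - x0) ^ k *\<^sub>R a k) sums \<phi> t)"
    using \<delta>(2)[unfolded real_analytic_on_def] \<delta>(1) by simp
  then obtain a r where r: "0 < r" "\<forall>t\<in>ball x0 r. (\<lambda>k. (t - x0) ^ k *\<^sub>R a k) sums \<phi> t"
    by (elim exE conjE)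
  define b where "b k = (a k, if k = 0 then x0 else if k = 1 then 1 else 0)" for k :: nat
  show ?thesis
  proof (intro exI[of _ "min r \<delta>"] exI[of _ b] exI[of _ "\<lambda>t. (\<phi> t, t)"] conjI ballI allI)
    show "0 < min r \<delta>" using r \<delta> by simp
  next
    fix t assume t: "t \<in> ball x0 (min r \<delta>)"
    have "(\<lambda>k. (t - x0) ^ k * (if k = 0 then x0 else if k = 1 then 1 else 0))
        sums (\<Sum>k\<in>{0, 1}. (t - x0) ^ k * (if k = 0 then x0 else if k = 1 then 1 else 0))"
      by (rule sums_finite) auto
    then have 2: "(\<lambda>k. (t - x0) ^ k * (if k = 0 then x0 else if k = 1 then 1 else 0)) sums t"
      by simp
    have 1: "(\<lambda>k. (t - x0) ^ k *\<^sub>R a k) sums \<phi> t" using r t by simp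
    show "(\<lambda>k. (t - x0) ^ k *\<^sub>R b k) sums (\<phi> t, t)"
      using tendsto_Pair[OF 1[unfolded sums_def] 2[unfolded sums_def]]
      by (simp add: sums_def b_def scaleR_Pair sum_prod)
  next
    fix t n l assume t: "t \<in> ball x0 (min r \<delta>)"
    have "torus_char n (\<Phi> (circle_exp t)) * cis (l * t)
        = cis (2 * pi * (\<Sum>j\<in>UNIV. of_int (n $ j) * \<phi> t $ j) + l * t)"
      using \<delta>(3) t by (simp add: torus_char_exp cis_mult)
    then show "torus_char n (\<Phi> (circle_exp t)) * cis (l * t)
        = cis ((2 * pi *\<^sub>R (\<chi> j. of_int (n $ j)), l) \<bullet> (\<phi> t, t))"
      by (simp add: inner_Pair inner_vec_def sum_distrib_left mult_ac)
  qed
qed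

lemma circle_map_char_C1:
  fixes \<Phi> :: "complex \<Rightarrow> complex ^ 'd"
  assumes \<Phi>: "real_analytic_circle_map \<Phi>"
  defines "G n t \<equiv> torus_char n (\<Phi> (circle_exp t))"
  shows "\<exists>G'. (\<forall>t. (G n has_vector_derivative G' t) (at t)) \<and> continuous_on UNIV G'"
proof -
  have loc: "\<exists>r>0. \<exists>G'. (\<forall>t\<in>ball x0 r. (G n has_vector_derivative G' t) (at t)) \<and> continuous_on (ball x0 r) G'" for x0
  proof -
    obtain r and a :: "nat \<Rightarrow> (real ^ 'd) \<times> real" and \<psi> where r: "0 < r"
      and "\<forall>t\<in>ball x0 r. (\<lambda>k. (t - x0) ^ k *\<^sub>R a k) sums \<psi> t"
      and "\<forall>t\<in>ball x0 r. \<forall>n l. torus_char n (\<Phi> (circle_exp t)) * cis (l * t)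
        = cis ((2 * pi *\<^sub>R (\<chi> j. of_int (n $ j)), l) \<bullet> \<psi> t)"
      using circle_map_local_data[OF \<Phi>, of x0] by (elim exE conjE)
    then have sums: "\<And>t. t \<in> ball x0 r \<Longrightarrow> (\<lambda>k. (t - x0) ^ k *\<^sub>R a k) sums \<psi> t"
      and eq: "\<And>t n l. t \<in> ball x0 r \<Longrightarrow>
        torus_char n (\<Phi> (circle_exp t)) * cis (l * t) = cis ((2 * pi *\<^sub>R (\<chi> j. of_int (n $ j)), l) \<bullet> \<psi> t)"
      by simp_all
    define D where "D = ps_deriv a x0 (2 * pi *\<^sub>R (\<chi> j. of_int (n $ j)), 0)"
    have ds: "deriv_seq D (ball x0 r)" unfolding D_def by (rule deriv_seq_ps_deriv) (rule sums)
    have G: "G n t = cis (D 0 t)" if "t \<in> ball x0 r" for t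
    proof -
      have "D 0 t = (2 * pi *\<^sub>R (\<chi> j. of_int (n $ j)), 0) \<bullet> \<psi> t"
        unfolding D_def by (rule ps_deriv_0[OF _ that]) (rule sums)
      then show ?thesis using eq[OF that, of n 0] by (simp add: G_def)
    qed
    define G' where "G' t = \<i> * of_real (D 1 t) * cis (D 0 t)" for t
    have "(G n has_vector_derivative G' t) (at t)" if t: "t \<in> ball x0 r" for t
    proof -
      have "((\<lambda>t. cis (D 0 t)) has_vector_derivative G' t) (at t)"
        unfolding G'_def using deriv_seqD[OF ds t, of 0] by (intro has_vector_derivative_cis) simp
      then show ?thesis
        by (rule has_vector_derivative_transform_within_open[OF _ open_ball t]) (simp add: G)
    qed
    moreover have "continuous_on (ball x0 r) G'"
      unfolding G'_def by (intro continuous_intros deriv_seq_cont[OF ds])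
    ultimately show ?thesis using r by blast
  qed
  define G' where "G' t = vector_derivative (G n) (at t)" for t
  have "(G n has_vector_derivative G' x) (at x)" for x
  proof -
    obtain r H where "0 < r" "\<forall>t\<in>ball x r. (G n has_vector_derivative H t) (at t)"
      using loc by blast
    then have "(G n has_vector_derivative H x) (at x)" by simp
    then show ?thesis unfolding G'_def by (simp add: vector_derivative_at)
  qed
  moreover have "isCont G' x" for x
  proof -
    obtain r H where r: "0 < r" "\<forall>t\<in>ball x r. (G n has_vector_derivative H t) (at t)" "continuous_on (ball x r) H"
      using loc by blast
    have e: "G' t = H t" if "t \<in> ball x r" for t
      unfolding G'_def using r(2) that by (intro vector_derivative_at) blast
    have "continuous_on (ball x r) G' \<longleftrightarrow> continuous_on (ball x r) H"
      by (rule continuous_on_cong[OF refl e])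
    then have "continuous_on (ball x r) G'" using r(3) by (rule iffD2)
    then show ?thesis using r(1) by (simp add: continuous_on_eq_continuous_at)
  qed
  ultimately show ?thesis by (metis continuous_at_imp_continuous_on)
qed

lemma circle_map_char_continuous:
  fixes \<Phi> :: "complex \<Rightarrow> complex ^ 'd"
  assumes "real_analytic_circle_map \<Phi>"
  shows "continuous_on UNIV (\<lambda>t. torus_char n (\<Phi> (circle_exp t)))"
proof -
  obtain G' where "\<forall>t. ((\<lambda>t. torus_char n (\<Phi> (circle_exp t))) has_vector_derivative G' t) (at t)"
    using circle_map_char_C1[OF assms, of n] by blast
  then show ?thesis
    by (meson continuous_at_imp_continuous_on has_vector_derivative_continuous)
qed

lemma circle_map_in_torus:
  assumes "real_analytic_circle_map \<Phi>"
  shows "\<Phi> (circle_exp t) \<in> torus"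
  using assms circle_exp_in_circle unfolding real_analytic_circle_map_def by blast

lemma circle_map_char_partial_sums_bounded:
  fixes \<Phi> :: "complex \<Rightarrow> complex ^ 'd"
  assumes \<Phi>: "real_analytic_circle_map \<Phi>"
  shows "\<exists>C\<ge>0. \<forall>n N. \<forall>z\<in>circle. norm (fourier_partial_sum (\<lambda>z. torus_char n (\<Phi> z)) N z) \<le> C"
proof -
  have "\<exists>\<delta>>0. \<exists>C. \<forall>x\<in>ball x0 \<delta>. \<forall>n N.
      norm (fourier_partial_sum (\<lambda>z. torus_char n (\<Phi> z)) N (circle_exp x)) \<le> C" for x0
  proof -
    obtain r and a :: "nat \<Rightarrow> (real ^ 'd) \<times> real" and \<psi> where r: "0 < r"
      and "\<forall>t\<in>ball x0 r. (\<lambda>k. (t - x0) ^ k *\<^sub>R a k) sums \<psi> t"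
      and "\<forall>t\<in>ball x0 r. \<forall>n l. torus_char n (\<Phi> (circle_exp t)) * cis (l * t)
        = cis ((2 * pi *\<^sub>R (\<chi> j. of_int (n $ j)), l) \<bullet> \<psi> t)"
      using circle_map_local_data[OF \<Phi>, of x0] by (elim exE conjE)
    then have sums: "\<And>t. t \<in> ball x0 r \<Longrightarrow> (\<lambda>k. (t - x0) ^ k *\<^sub>R a k) sums \<psi> t"
      and eq: "\<And>t n l. t \<in> ball x0 r \<Longrightarrow>
        torus_char n (\<Phi> (circle_exp t)) * cis (l * t) = cis ((2 * pi *\<^sub>R (\<chi> j. of_int (n $ j)), l) \<bullet> \<psi> t)"
      by simp_all
    obtain \<delta> C where \<delta>: "0 < \<delta>" "\<delta> \<le> 1/4" "2 * \<delta> \<le> r"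
      and C: "\<And>x v e. x \<in> ball x0 \<delta> \<Longrightarrow> 0 < e \<Longrightarrow> e \<le> \<delta> \<Longrightarrow> norm (osc (\<lambda>t. v \<bullet> \<psi> (x + t)) e \<delta>) \<le> C"
    proof -
      have "\<exists>\<delta>>0. \<delta> \<le> 1/4 \<and> 2 * \<delta> \<le> r \<and> (\<exists>C. \<forall>x\<in>ball x0 \<delta>. \<forall>v e. 0 < e \<longrightarrow> e \<le> \<delta> \<longrightarrow>
          norm (osc (\<lambda>t. v \<bullet> \<psi> (x + t)) e \<delta>) \<le> C)"
        by (rule analytic_osc_bounded[OF r]) (rule sums)
      then show ?thesis using that by blast
    qed
    have "norm (fourier_partial_sum (\<lambda>z. torus_char n (\<Phi> z)) N (circle_exp x)) \<le> 1 + 2 / \<delta> + C + pi"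
      if x: "x \<in> ball x0 \<delta>" for x n N
    proof (rule fourier_partial_sum_locally_bounded[OF circle_map_char_continuous[OF \<Phi>] _ \<delta>(1,2)])
      show "norm (torus_char n (\<Phi> (circle_exp t))) \<le> 1" for t
        by (simp add: norm_torus_char circle_map_in_torus[OF \<Phi>])
      fix l e :: real assume e: "0 < e" "e \<le> \<delta>"
      let ?G = "\<lambda>t. torus_char n (\<Phi> (circle_exp t))"
      let ?v = "(2 * pi *\<^sub>R (\<chi> j. of_int (n $ j)), l) :: (real ^ 'd) \<times> real"
      have G: "?G (x + t) * cis (l * t) = cis (- (l * x)) * cis (?v \<bullet> \<psi> (x + t))" if "\<bar>t\<bar> \<le> \<delta>" for t
      proof -
        have "x + t \<in> ball x0 r"
          using x that \<delta>(3) unfolding mem_ball dist_real_def by linarith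
        from eq[OF this, of n l]
        have "cis (- (l * x)) * cis (?v \<bullet> \<psi> (x + t)) = ?G (x + t) * (cis (- (l * x)) * cis (l * (x + t)))"
          by (simp add: mult_ac)
        also have "cis (- (l * x)) * cis (l * (x + t)) = cis (l * t)"
          by (simp add: cis_mult algebra_simps)
        finally show ?thesis by simp
      qed
      have "integral {e..\<delta>} (\<lambda>t. (?G (x + t) * cis (l * t) - ?G (x - t) * cis (- (l * t))) / of_real t)
          = integral {e..\<delta>} (\<lambda>t. cis (- (l * x)) * ((cis (?v \<bullet> \<psi> (x + t)) - cis (?v \<bullet> \<psi> (x + - t))) / of_real t))"
      proof (rule integral_cong)
        fix t assume "t \<in> {e..\<delta>}"
        then have "\<bar>t\<bar> \<le> \<delta>" "\<bar>- t\<bar> \<le> \<delta>" using e by auto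
        from G[OF this(1)] G[OF this(2)]
        show "(?G (x + t) * cis (l * t) - ?G (x - t) * cis (- (l * t))) / of_real t
            = cis (- (l * x)) * ((cis (?v \<bullet> \<psi> (x + t)) - cis (?v \<bullet> \<psi> (x + - t))) / of_real t)"
          by (simp add: right_diff_distrib)
      qed
      also have "\<dots> = cis (- (l * x)) * osc (\<lambda>t. ?v \<bullet> \<psi> (x + t)) e \<delta>"
        unfolding osc_def by (rule integral_mult_right)
      finally show "norm (integral {e..\<delta>} (\<lambda>t. (?G (x + t) * cis (l * t) - ?G (x - t) * cis (- (l * t))) / of_real t)) \<le> C"
        using C[OF x e, of ?v] by (simp add: norm_mult)
    qed
    then show ?thesis using \<delta>(1) by blast
  qed
  then obtain \<delta> C where \<delta>: "\<And>x0. 0 < \<delta> x0"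
    and C: "\<And>x0 x n N. x \<in> ball x0 (\<delta> x0) \<Longrightarrow>
      norm (fourier_partial_sum (\<lambda>z. torus_char n (\<Phi> z)) N (circle_exp x)) \<le> C x0"
    by metis
  have cover: "{0..1} \<subseteq> (\<Union>x0\<in>{0..1}. ball x0 (\<delta> x0))"
  proof
    fix x :: real assume "x \<in> {0..1}"
    then show "x \<in> (\<Union>x0\<in>{0..1}. ball x0 (\<delta> x0))" using \<delta>[of x] by (intro UN_I[of x]) auto
  qed
  obtain T where T: "T \<subseteq> {0..1}" "finite T" "{0..1} \<subseteq> (\<Union>x0\<in>T. ball x0 (\<delta> x0))"
    by (rule compactE_image[OF compact_Icc _ cover]) auto
  define B where "B = (\<Sum>x0\<in>T. \<bar>C x0\<bar>)"
  have "norm (fourier_partial_sum (\<lambda>z. torus_char n (\<Phi> z)) N z) \<le> B" if z: "z \<in> circle" for n N z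
  proof -
    obtain x where x: "x \<in> {0..1}" "z = circle_exp x" using z circle_eq_image by blast
    then obtain x0 where x0: "x0 \<in> T" "x \<in> ball x0 (\<delta> x0)" using T by blast
    have "norm (fourier_partial_sum (\<lambda>z. torus_char n (\<Phi> z)) N z) \<le> C x0"
      unfolding x(2) by (rule C[OF x0(2)])
    also have "\<dots> \<le> \<bar>C x0\<bar>" by simp
    also have "\<dots> \<le> B" unfolding B_def using x0(1) T(2) by (intro member_le_sum) auto
    finally show ?thesis .
  qed
  moreover have "0 \<le> B" unfolding B_def by (intro sum_nonneg) auto
  ultimately show ?thesis by blast
qed

lemma fourier_partial_sum_diff:
  assumes "continuous_on UNIV (\<lambda>t. g (circle_exp t))" "continuous_on UNIV (\<lambda>t. h (circle_exp t))"
  shows "fourier_partial_sum (\<lambda>z. g z - h z) N z = fourier_partial_sum g N z - fourier_partial_sum h N z"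
proof -
  have "fourier_coeff (\<lambda>z. g z - h z) n = fourier_coeff g n - fourier_coeff h n" for n
  proof -
    have "continuous_on {0..1} (\<lambda>t. g (circle_exp t))" "continuous_on {0..1} (\<lambda>t. h (circle_exp t))"
      using assms by (auto intro: continuous_on_subset)
    then show ?thesis using assms
      by (simp add: fourier_coeff_integral continuous_on_diff left_diff_distrib)
        (intro integral_diff integrable_continuous_real continuous_intros)
  qed
  then show ?thesis by (simp add: fourier_partial_sum_def left_diff_distrib sum_subtractf)
qed

lemma fourier_partial_sum_sum:
  assumes "\<And>n. n \<in> A \<Longrightarrow> continuous_on UNIV (\<lambda>t. h n (circle_exp t))" "finite A"
  shows "fourier_partial_sum (\<lambda>z. \<Sum>n\<in>A. c n * h n z) N z = (\<Sum>n\<in>A. c n * fourier_partial_sum (h n) N z)"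
proof -
  have "fourier_coeff (\<lambda>z. \<Sum>n\<in>A. c n * h n z) m = (\<Sum>n\<in>A. c n * fourier_coeff (h n) m)" for m
  proof -
    have "fourier_coeff (\<lambda>z. \<Sum>n\<in>A. c n * h n z) m
        = integral {0..1} (\<lambda>t. \<Sum>n\<in>A. c n * (h n (circle_exp t) * cis (- (2 * pi * of_int m * t))))"
      using assms by (simp add: fourier_coeff_integral continuous_on_sum continuous_on_mult_left sum_distrib_right mult.assoc)
    also have "\<dots> = (\<Sum>n\<in>A. integral {0..1} (\<lambda>t. c n * (h n (circle_exp t) * cis (- (2 * pi * of_int m * t)))))"
      using assms
      by (intro integral_sum integrable_continuous_real continuous_intros) (auto intro: continuous_on_subset)
    also have "\<dots> = (\<Sum>n\<in>A. c n * fourier_coeff (h n) m)"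
      using assms by (simp add: fourier_coeff_integral)
    finally show ?thesis .
  qed
  then show ?thesis
    unfolding fourier_partial_sum_def
    by (simp add: sum_distrib_right sum_distrib_left mult.assoc) (rule sum.swap)
qed

lemma norm_fourier_partial_sum_le:
  assumes c: "continuous_on UNIV (\<lambda>t. g (circle_exp t))" and B: "\<And>z. z \<in> circle \<Longrightarrow> norm (g z) \<le> B"
    and z: "z \<in> circle"
  shows "norm (fourier_partial_sum g N z) \<le> (2 * real N + 1) * B"
proof -
  have coeff: "norm (fourier_coeff g n) \<le> B" for n
  proof -
    have "norm (fourier_coeff g n) \<le> integral {0..1} (\<lambda>t::real. B)"
      unfolding fourier_coeff_integral[OF c]
      by (intro integral_norm_bound_integral integrable_continuous_real continuous_intros continuous_on_subset[OF c])
        (auto simp: norm_mult B circle_exp_in_circle)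
    then show ?thesis by simp
  qed
  have "norm (fourier_partial_sum g N z) \<le> (\<Sum>n = - int N..int N. norm (fourier_coeff g n * z powi n))"
    unfolding fourier_partial_sum_def by (rule norm_sum)
  also have "\<dots> \<le> (\<Sum>n = - int N..int N. B)"
    using coeff z by (intro sum_mono) (simp add: norm_mult norm_power_int circle_def)
  finally show ?thesis by simp
qed

theorem proposition1p1:
  fixes \<Phi> :: "complex \<Rightarrow> complex ^ 'd" and f :: "complex ^ 'd \<Rightarrow> complex"
  assumes "real_analytic_circle_map \<Phi>"
    and "f \<in> A_space"
  shows "f \<circ> \<Phi> \<in> U_space"
proof -
  note \<Phi> = assms(1)
  define c where "c n = torus_fourier_coeff f n" for n
  define h where "h n z = torus_char n (\<Phi> z)" for n z
  define s where "s A z = (\<Sum>n\<in>A. c n * h n z)" for A z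
  define g where "g = f \<circ> \<Phi>"
  have sm: "(\<lambda>n. norm (c n)) summable_on UNIV"
    using assms(2) by (simp add: A_space_def c_def)
  have lim: "uniform_limit circle s g (finite_subsets_at_top UNIV)"
  proof -
    have "\<Phi> ` circle \<subseteq> torus" using \<Phi> by (simp add: real_analytic_circle_map_def)
    from uniform_limit_compose'[OF A_space_expansion[OF assms(2)], of \<Phi> circle] this
    show ?thesis unfolding s_def[abs_def] g_def h_def[abs_def] c_def o_def by auto
  qed
  have ch: "continuous_on UNIV (\<lambda>t. h n (circle_exp t))" for n
    unfolding h_def by (rule circle_map_char_continuous[OF \<Phi>])
  have cs: "continuous_on UNIV (\<lambda>t. s A (circle_exp t))" for A
    unfolding s_def by (intro continuous_intros ch)
  have cg: "continuous_on UNIV (\<lambda>t. g (circle_exp t))"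
  proof (rule uniform_limit_theorem)
    show "uniform_limit UNIV (\<lambda>A t. s A (circle_exp t)) (\<lambda>t. g (circle_exp t)) (finite_subsets_at_top UNIV)"
      by (rule uniform_limit_compose'[OF lim]) (simp add: circle_exp_in_circle)
  qed (simp_all add: cs)
  obtain C where C0: "0 \<le> C" and C: "\<And>n N z. z \<in> circle \<Longrightarrow> norm (fourier_partial_sum (h n) N z) \<le> C"
    using circle_map_char_partial_sums_bounded[OF \<Phi>] unfolding h_def[abs_def] by blast
  have conv: "\<exists>N0. \<forall>N\<ge>N0. \<forall>z\<in>circle. norm (fourier_partial_sum (h n) N z - h n z) \<le> e" if "0 < e" for n e
  proof -
    obtain G' where "\<And>t. ((\<lambda>t. h n (circle_exp t)) has_vector_derivative G' t) (at t)" "continuous_on UNIV G'"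
      using circle_map_char_C1[OF \<Phi>, of n] unfolding h_def by blast
    from fourier_partial_sum_tendsto_C1[OF this that] show ?thesis
      unfolding circle_eq_image by auto
  qed
  have ulim: "\<exists>N0. \<forall>N\<ge>N0. \<forall>z\<in>circle. norm (fourier_partial_sum g N z - g z) < e" if e: "0 < e" for e
  proof -
    define d where "d = e / (C + 4)"
    have d: "0 < d" "(C + 4) * d = e" using e C0 by (simp_all add: d_def)
    obtain X where X: "finite X" "\<And>A. finite A \<Longrightarrow> X \<subseteq> A \<Longrightarrow> \<forall>z\<in>circle. dist (s A z) (g z) < d"
      using uniform_limitD[OF lim d(1)] unfolding eventually_finite_subsets_at_top by auto
    obtain Y where Y: "finite Y" "\<And>A. finite A \<Longrightarrow> Y \<subseteq> A \<Longrightarrow>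
        dist (\<Sum>n\<in>A. norm (c n)) (\<Sum>\<^sub>\<infinity>n. norm (c n)) < d / 2"
    proof -
      have "((\<lambda>A. \<Sum>n\<in>A. norm (c n)) \<longlongrightarrow> (\<Sum>\<^sub>\<infinity>n. norm (c n))) (finite_subsets_at_top UNIV)"
        using has_sum_infsum[OF sm] by (simp add: has_sum_def)
      then have "\<forall>\<^sub>F A in finite_subsets_at_top UNIV. dist (\<Sum>n\<in>A. norm (c n)) (\<Sum>\<^sub>\<infinity>n. norm (c n)) < d / 2"
        using d(1) by (intro tendstoD) auto
      then show ?thesis using that unfolding eventually_finite_subsets_at_top by auto
    qed
    define A where "A = X \<union> Y"
    have A: "finite A" using X Y by (simp add: A_def)
    have tail: "(\<Sum>n\<in>B - A. norm (c n)) \<le> d" if B: "finite B" "A \<subseteq> B" for B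
    proof -
      have "(\<Sum>n\<in>B - A. norm (c n)) = (\<Sum>n\<in>B. norm (c n)) - (\<Sum>n\<in>A. norm (c n))"
        using B by (simp add: sum_diff)
      moreover have "dist (\<Sum>n\<in>B. norm (c n)) (\<Sum>\<^sub>\<infinity>n. norm (c n)) < d / 2" "dist (\<Sum>n\<in>A. norm (c n)) (\<Sum>\<^sub>\<infinity>n. norm (c n)) < d / 2"
        by (rule Y(2); use B A in \<open>simp add: A_def\<close>)+
      ultimately show ?thesis unfolding dist_real_def by linarith
    qed
    have head: "norm (fourier_partial_sum g N z - fourier_partial_sum (s A) N z) \<le> (C + 1) * d" if z: "z \<in> circle" for N z
    proof -
      define w where "w = d / (2 * real N + 1)"
      have w: "0 < w" "(2 * real N + 1) * w = d" using d by (simp_all add: w_def)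
      obtain X' where X': "finite X'" "\<And>A. finite A \<Longrightarrow> X' \<subseteq> A \<Longrightarrow> \<forall>z\<in>circle. dist (s A z) (g z) < w"
        using uniform_limitD[OF lim w(1)] unfolding eventually_finite_subsets_at_top by auto
      define B where "B = A \<union> X'"
      have B: "finite B" "A \<subseteq> B" using A X' by (auto simp: B_def)
      have "norm (fourier_partial_sum (\<lambda>z. g z - s B z) N z) \<le> (2 * real N + 1) * w"
      proof (rule norm_fourier_partial_sum_le[OF _ _ z])
        show "continuous_on UNIV (\<lambda>t. g (circle_exp t) - s B (circle_exp t))"
          by (intro continuous_intros cg cs)
        show "norm (g z - s B z) \<le> w" if "z \<in> circle" for z
          using X'(2)[of B] B that by (auto simp: B_def dist_norm norm_minus_commute intro: less_imp_le)
      qed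
      then have 1: "norm (fourier_partial_sum g N z - fourier_partial_sum (s B) N z) \<le> d"
        by (simp only: fourier_partial_sum_diff[OF cg cs] w(2))
      have S: "fourier_partial_sum (s E) N z = (\<Sum>n\<in>E. c n * fourier_partial_sum (h n) N z)" if "finite E" for E
        unfolding s_def[abs_def] by (rule fourier_partial_sum_sum[OF ch that])
      have "fourier_partial_sum (s B) N z - fourier_partial_sum (s A) N z
          = (\<Sum>n\<in>B - A. c n * fourier_partial_sum (h n) N z)"
        using A B by (simp add: S sum_diff)
      also have "norm \<dots> \<le> (\<Sum>n\<in>B - A. norm (c n) * C)"
        by (intro sum_norm_le) (simp add: norm_mult mult_left_mono C[OF z])
      also have "\<dots> = (\<Sum>n\<in>B - A. norm (c n)) * C" by (simp add: sum_distrib_right)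
      also have "\<dots> \<le> d * C" by (intro mult_right_mono tail B C0)
      finally have "norm (fourier_partial_sum (s B) N z - fourier_partial_sum (s A) N z) \<le> d * C" .
      with 1 show ?thesis
        using norm_triangle_ineq[of "fourier_partial_sum g N z - fourier_partial_sum (s B) N z"
            "fourier_partial_sum (s B) N z - fourier_partial_sum (s A) N z"]
        by (simp add: algebra_simps)
    qed
    have "\<exists>N0. \<forall>N\<ge>N0. \<forall>z\<in>circle. norm (fourier_partial_sum (s A) N z - s A z) \<le> d"
    proof -
      define q where "q = d / (1 + (\<Sum>n\<in>A. norm (c n)))"
      have sA: "0 \<le> (\<Sum>n\<in>A. norm (c n))" by (intro sum_nonneg) simp
      have q: "0 < q" "(1 + (\<Sum>n\<in>A. norm (c n))) * q = d" using d sA by (simp_all add: q_def)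
      obtain N0 where N0: "\<And>n N z. N \<ge> N0 n \<Longrightarrow> z \<in> circle \<Longrightarrow> norm (fourier_partial_sum (h n) N z - h n z) \<le> q"
        using conv[OF q(1)] by metis
      have "norm (fourier_partial_sum (s A) N z - s A z) \<le> d"
        if N: "N \<ge> Max (insert 0 (N0 ` A))" and z: "z \<in> circle" for N z
      proof -
        have NN: "N0 n \<le> N" if "n \<in> A" for n using N A that by simp
        have "fourier_partial_sum (s A) N z - s A z = (\<Sum>n\<in>A. c n * (fourier_partial_sum (h n) N z - h n z))"
          unfolding s_def[abs_def] fourier_partial_sum_sum[OF ch A]
          by (simp add: sum_subtractf right_diff_distrib)
        also have "norm \<dots> \<le> (\<Sum>n\<in>A. norm (c n) * q)"
          by (intro sum_norm_le) (simp add: norm_mult mult_left_mono N0 NN z)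
        also have "\<dots> = (\<Sum>n\<in>A. norm (c n)) * q" by (simp add: sum_distrib_right)
        also have "\<dots> \<le> (1 + (\<Sum>n\<in>A. norm (c n))) * q" using q(1) by (intro mult_right_mono) auto
        finally show ?thesis by (simp only: q(2))
      qed
      then show ?thesis by blast
    qed
    then obtain N0 where N0: "\<And>N z. N0 \<le> N \<Longrightarrow> z \<in> circle \<Longrightarrow> norm (fourier_partial_sum (s A) N z - s A z) \<le> d"
      by blast
    have "norm (fourier_partial_sum g N z - g z) < e" if "N0 \<le> N" and z: "z \<in> circle" for N z
    proof -
      have "norm (s A z - g z) < d"
        using X(2)[OF A] z by (auto simp: A_def dist_norm)
      moreover have "norm (fourier_partial_sum g N z - g z)
          \<le> norm (fourier_partial_sum g N z - fourier_partial_sum (s A) N z)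
            + (norm (fourier_partial_sum (s A) N z - s A z) + norm (s A z - g z))"
      proof -
        have "fourier_partial_sum g N z - g z = (fourier_partial_sum g N z - fourier_partial_sum (s A) N z)
            + ((fourier_partial_sum (s A) N z - s A z) + (s A z - g z))" by simp
        then show ?thesis by (metis norm_triangle_ineq norm_triangle_mono order_refl)
      qed
      ultimately have "norm (fourier_partial_sum g N z - g z) \<le> (C + 1) * d + (d + d)"
        using head[OF z, of N] N0[OF that] by linarith
      also have "\<dots> < (C + 4) * d" using d by (simp add: algebra_simps)
      finally show ?thesis by (simp only: d(2))
    qed
    then show ?thesis by blast
  qed
  have "uniform_limit circle (fourier_partial_sum g) g sequentially"
    unfolding uniform_limit_sequentially_iff dist_norm using ulim by blast
  moreover from this have "continuous_on circle g"
  proof (rule uniform_limit_theorem[rotated])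
    have "z \<noteq> 0" if "z \<in> circle" for z using that by (auto simp: circle_def)
    then show "\<forall>\<^sub>F N in sequentially. continuous_on circle (fourier_partial_sum g N)"
      unfolding fourier_partial_sum_def by (intro always_eventually allI continuous_intros) auto
  qed simp
  ultimately show ?thesis by (simp add: U_space_def g_def)
qed

end
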